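(* Let $H$ be a plane graph whose interior faces $F_1,\dots,F_n$ are each bounded by a cycle, and let $G$ be its weak dual, with vertex set $\{v_1,\dots,v_n\}$, where $v_i$ corresponds to $F_i$. Let $c\in\mathbb{N}^n$ be given by $c_i=c(F_i)$, the length of the cycle bounding $F_i$. Then for every $k$, the ideal of $\mathbb{Z}$ obtained by evaluating the critical ideal $I_k(G)$ at $X=c$ is generated by $\Delta_k(C(H))$. Moreover, $f_1(C(H))\geq\gamma(G)$.
   Context: Weak dual $G_*$ of a plane graph: the dual graph (one vertex per face, one edge crossing each edge of the plane graph) with the vertex of the outer face deleted; it may have multiple edges. For a graph $G$ on $n$ vertices, $A(G)$ is its adjacency matrix, with $(i,j)$-entry the number of edges between $v_i$ and $v_j$. Set $A_X(G)=\operatorname{diag}(x_1,\dots,x_n)-A(G)$, with indeterminates $X=(x_1,\dots,x_n)$. The $k$-th critical ideal $I_k(G)\subseteq\mathbb{Z}[X]$ is the ideal generated by the $k\times k$ minors of $A_X(G)$, with the conventions $I_k=\langle 1\rangle$ for $k<1$ and $I_k=\langle 0\rangle$ for $k>n$. The algebraic co-rank $\gamma(G)$ is the number of critical ideals of $G$ equal to $\langle 1\rangle$. The cycle-intersection matrix $C(H)=(c_{ij})$ is the symmetric $n\times n$ integer matrix with $c_{ii}=c(F_i)$ and, for $i\neq j$, $c_{ij}=-$(number of edges common to the cycles bounding $F_i$ and $F_j$). For an integer matrix $M$, $\Delta_k(M)$ is the gcd of its $k\times k$ minors, and $f_1(M)$ is the number of invariant factors of $M$ (diagonal entries of its Smith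 normal form) equal to $1$. *)

theory Defs
  imports
    "HOL-Analysis.Analysis"
    "HOL-Library.Poly_Mapping"
    "HOL-Algebra.IntRing"
    "Jordan_Normal_Form.Determinant"
    "Jordan_Normal_Form.DL_Submatrix"
begin

section \<open>Multigraphs\<close>

text \<open>An edge with two end vertices is an ordinary edge, an edge with one end vertex is a loop.\<close>

record ('v, 'e) multigraph =
  mverts :: "'v set"
  medges :: "'e set"
  mends :: "'e \<Rightarrow> 'v set"

definition delete_vertex :: "('v, 'e) multigraph \<Rightarrow> 'v \<Rightarrow> ('v, 'e) multigraph" where
  "delete_vertex G v =
     \<lparr>mverts = mverts G - {v}, medges = {e \<in> medges G. v \<notin> mends G e}, mends = mends G\<rparr>"

text \<open>A list \<open>vs\<close> enumerates the vertices; indices start at 0.\<close>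

definition adjacency_matrix :: "('v, 'e) multigraph \<Rightarrow> 'v list \<Rightarrow> nat mat" where
  "adjacency_matrix G vs =
     mat (length vs) (length vs) (\<lambda>(i, j). card {e \<in> medges G. mends G e = {vs ! i, vs ! j}})"


section \<open>Plane graphs and their weak duals\<close>

text \<open>
  The plane is \<open>complex\<close>, and an edge is identified with its point set.  Parallel edges are
  allowed, and so are loops: a simple path may be closed.
\<close>

record plane_drawing =
  pverts :: "complex set"
  pedges :: "complex set set"

definition plane_graph :: "plane_drawing \<Rightarrow> bool" where
  "plane_graph H \<longleftrightarrow>
     finite (pverts H) \<and> finite (pedges H) \<and>
     (\<forall>e \<in> pedges H. \<exists>g. simple_path g \<and> path_image g = e \<and>
        e \<inter> pverts H = {pathstart g, pathfinish g}) \<and>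
     (\<forall>e \<in> pedges H. \<forall>e' \<in> pedges H. e \<noteq> e' \<longrightarrow> e \<inter> e' \<subseteq> pverts H)"

definition edge_ends :: "plane_drawing \<Rightarrow> complex set \<Rightarrow> complex set" where
  "edge_ends H e = e \<inter> pverts H"

definition faces :: "plane_drawing \<Rightarrow> complex set set" where
  "faces H = components (- (pverts H \<union> \<Union> (pedges H)))"

definition outer_face :: "plane_drawing \<Rightarrow> complex set" where
  "outer_face H = (THE f. f \<in> faces H \<and> \<not> bounded f)"

definition interior_faces :: "plane_drawing \<Rightarrow> complex set set" where
  "interior_faces H = faces H - {outer_face H}"

text \<open>
  The dual edge crossing \<open>e\<close> is labelled by \<open>e\<close> itself.  It joins the faces on the two sides of
  \<open>e\<close>, that is, the faces having \<open>e\<close> in their boundary; if there is only one, it is a loop.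
\<close>

definition dual_graph :: "plane_drawing \<Rightarrow> (complex set, complex set) multigraph" where
  "dual_graph H =
     \<lparr>mverts = faces H, medges = pedges H, mends = (\<lambda>e. {f \<in> faces H. e \<subseteq> frontier f})\<rparr>"

definition weak_dual :: "plane_drawing \<Rightarrow> (complex set, complex set) multigraph" where
  "weak_dual H = delete_vertex (dual_graph H) (outer_face H)"

text \<open>Edge sets of cycles; a loop is a cycle of length 1, two parallel edges one of length 2.\<close>

definition is_cycle :: "plane_drawing \<Rightarrow> complex set set \<Rightarrow> bool" where
  "is_cycle H Z \<longleftrightarrow>
     (\<exists>vs es. distinct vs \<and> distinct es \<and> es \<noteq> [] \<and> length vs = length es \<and>
        set vs \<subseteq> pverts H \<and> set es \<subseteq> pedges H \<and> Z = set es \<and>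
        (\<forall>i < length es. edge_ends H (es ! i) = {vs ! i, vs ! (Suc i mod length es)}))"

definition bounded_by_cycle :: "plane_drawing \<Rightarrow> complex set \<Rightarrow> complex set set \<Rightarrow> bool" where
  "bounded_by_cycle H f Z \<longleftrightarrow> is_cycle H Z \<and> \<Union> Z = frontier f"

text \<open>The bounding cycle is unique, since \<open>Z\<close> consists of the edges contained in \<open>frontier f\<close>.\<close>

definition bounding_cycle :: "plane_drawing \<Rightarrow> complex set \<Rightarrow> complex set set" where
  "bounding_cycle H f = (THE Z. bounded_by_cycle H f Z)"

definition cycle_length :: "plane_drawing \<Rightarrow> complex set \<Rightarrow> nat" where
  "cycle_length H f = card (bounding_cycle H f)"

definition cycle_intersection_matrix :: "plane_drawing \<Rightarrow> complex set list \<Rightarrow> int mat" where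
  "cycle_intersection_matrix H fs =
     mat (length fs) (length fs) (\<lambda>(i, j).
       if i = j then int (cycle_length H (fs ! i))
       else - int (card (bounding_cycle H (fs ! i) \<inter> bounding_cycle H (fs ! j))))"


section \<open>Minors and Smith normal form\<close>

definition minors :: "nat \<Rightarrow> 'a::comm_ring_1 mat \<Rightarrow> 'a set" where
  "minors k A =
     {det (submatrix A I J) | I J.
        I \<subseteq> {..<dim_row A} \<and> J \<subseteq> {..<dim_col A} \<and> card I = k \<and> card J = k}"

text \<open>For \<open>k < 1\<close> we take the gcd to be 1, in line with the convention for critical ideals.\<close>

definition Delta :: "int \<Rightarrow> int mat \<Rightarrow> int" where
  "Delta k M = (if k < 1 then 1 else Gcd (minors (nat k) M))"

definition is_smith_normal_form :: "int mat \<Rightarrow> int mat \<Rightarrow> bool" where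
  "is_smith_normal_form M S \<longleftrightarrow>
     (\<exists>P Q. P \<in> carrier_mat (dim_row M) (dim_row M) \<and> Q \<in> carrier_mat (dim_col M) (dim_col M) \<and>
        invertible_mat P \<and> invertible_mat Q \<and> S = P * M * Q) \<and>
     diagonal_mat S \<and>
     (\<forall>i < min (dim_row S) (dim_col S). 0 \<le> S $$ (i, i)) \<and>
     (\<forall>i. Suc i < min (dim_row S) (dim_col S) \<longrightarrow> S $$ (i, i) dvd S $$ (Suc i, Suc i))"

text \<open>The Smith normal form exists and is unique, so the choice below is immaterial.\<close>

definition smith_normal_form :: "int mat \<Rightarrow> int mat" where
  "smith_normal_form M = (SOME S. is_smith_normal_form M S)"

definition f1 :: "int mat \<Rightarrow> nat" where
  "f1 M = card {i. i < min (dim_row M) (dim_col M) \<and> smith_normal_form M $$ (i, i) = 1}"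


section \<open>Critical ideals\<close>

text \<open>
  Integer polynomials are finitely supported maps from monomials (exponent vectors) to
  coefficients.  The type has an indeterminate for every natural number; \<open>int_poly_ring n\<close> is its
  subring of polynomials in the first \<open>n\<close> of them.
\<close>

type_synonym int_mpoly = "(nat \<Rightarrow>\<^sub>0 nat) \<Rightarrow>\<^sub>0 int"

definition indet :: "nat \<Rightarrow> int_mpoly" where
  "indet i = Poly_Mapping.single (Poly_Mapping.single i 1) 1"

definition int_poly_ring :: "nat \<Rightarrow> int_mpoly ring" where
  "int_poly_ring n =
     \<lparr>carrier = {p. \<forall>m \<in> Poly_Mapping.keys p. Poly_Mapping.keys m \<subseteq> {..<n}},
      mult = (*), one = 1, zero = 0, add = (+)\<rparr>"

definition poly_eval :: "(nat \<Rightarrow> int) \<Rightarrow> int_mpoly \<Rightarrow> int" where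
  "poly_eval x p =
     (\<Sum>m \<in> Poly_Mapping.keys p.
        Poly_Mapping.lookup p m *
        (\<Prod>i \<in> Poly_Mapping.keys m. x i ^ Poly_Mapping.lookup m i))"

definition generalized_laplacian :: "('v, 'e) multigraph \<Rightarrow> 'v list \<Rightarrow> int_mpoly mat" where
  "generalized_laplacian G vs =
     mat_diag (length vs) indet - map_mat of_nat (adjacency_matrix G vs)"

definition critical_ideal :: "('v, 'e) multigraph \<Rightarrow> 'v list \<Rightarrow> int \<Rightarrow> int_mpoly set" where
  "critical_ideal G vs k =
     (let R = int_poly_ring (length vs) in
      if k < 1 then Idl\<^bsub>R\<^esub> {1}
      else if k > int (length vs) then Idl\<^bsub>R\<^esub> {0}
      else Idl\<^bsub>R\<^esub> (minors (nat k) (generalized_laplacian G vs)))"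

text \<open>As usual, only indices \<open>k \<ge> 1\<close> are counted, the ideal being trivial by convention below.\<close>

definition algebraic_corank :: "('v, 'e) multigraph \<Rightarrow> 'v list \<Rightarrow> nat" where
  "algebraic_corank G vs =
     card {k. 1 \<le> k \<and> critical_ideal G vs k = Idl\<^bsub>int_poly_ring (length vs)\<^esub> {1}}"

end

theory Submission
  imports Defs "Jordan_Normal_Form.Column_Operations" "HOL-Number_Theory.Cong"
begin

text \<open>
  Evaluated at the cycle lengths, the generalized Laplacian of the weak dual becomes \<open>C(H)\<close>: the
  edges in the boundary of an interior face are those of its cycle, an edge borders at most two faces
  (Janiszewski's theorem), and an edge on a bounding cycle borders exactly two (Jordan's theorem), so
  that the weak dual has no loops.  Evaluation is a surjective ring homomorphism onto the integers and
  maps minors to minors, so it maps each critical ideal to the ideal generated by the gcd of the minors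
  of \<open>C(H)\<close>.  In particular \<open>\<Delta>\<^sub>k = 1\<close> whenever the \<open>k\<close>-th critical ideal is trivial, and then the first
  \<open>k\<close> invariant factors must be 1, for otherwise one of them other than 1 would divide all \<open>k\<close>-minors.
\<close>

section \<open>Edges and faces of a plane drawing\<close>

lemma simple_path_eqD:
  assumes "simple_path g" "g s = g t" "0 \<le> s" "s \<le> 1" "0 < t" "t < 1"
  shows "s = t"
  using assms unfolding simple_path_def loop_free_def by force

lemma compact_simple_path_segment:
  fixes g :: "real \<Rightarrow> 'a::metric_space"
  assumes "simple_path g" "0 \<le> s" "t \<le> 1"
  shows "compact (g ` {s..t})"
proof -
  have "continuous_on {0..1} g"
    using assms(1) by (simp add: simple_path_def path_def)
  then have "continuous_on {s..t} g"
    by (rule continuous_on_subset) (use assms in auto)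
  then show ?thesis
    by (rule compact_continuous_image) simp
qed

lemma connected_component_via_point:
  assumes "connected A" "connected B" "x \<in> A" "y \<in> B" "p \<in> closure A" "p \<in> closure B"
    "A \<subseteq> U" "B \<subseteq> U" "p \<in> U"
  shows "connected_component U x y"
  unfolding connected_component_def
proof (intro exI conjI)
  have "insert p A \<subseteq> closure A" "insert p B \<subseteq> closure B"
    using assms(5,6) closure_subset by auto
  then have "connected (insert p A)" "connected (insert p B)"
    using connected_intermediate_closure[OF assms(1)] connected_intermediate_closure[OF assms(2)]
    by blast+
  then show "connected (insert p A \<union> insert p B)"
    by (rule connected_Un) auto
qed (use assms in auto)

text \<open>\<open>D\<close> stands for a drawing, \<open>g\<close> for one of its edges and \<open>K\<close> for the rest of the drawing.\<close>

locale drawn_edge =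
  fixes K D :: "complex set" and g :: "real \<Rightarrow> complex"
  assumes compact_rest: "compact K"
    and simple_path_edge: "simple_path g"
    and rest_Int_edge: "K \<inter> path_image g = {pathstart g, pathfinish g}"
    and drawing_eq: "D = K \<union> path_image g"
begin

definition trimmed :: "real \<Rightarrow> real \<Rightarrow> complex set" where
  "trimmed s t = K \<union> g ` {0..s} \<union> g ` {t..1}"

lemma edge_eq_iff: "g s = g t \<longleftrightarrow> s = t" if "0 \<le> s" "s \<le> 1" "0 < t" "t < 1"
  using simple_path_eqD[OF simple_path_edge] that by blast

lemma path_image_edge: "path_image g = g ` {0..1}"
  by (simp add: path_image_def)

lemma edge_notin_rest: "g t \<notin> K" if "0 < t" "t < 1"
proof
  assume "g t \<in> K"
  then have "g t \<in> {g 0, g 1}"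
    using rest_Int_edge that unfolding path_image_def pathstart_def pathfinish_def by fastforce
  then show False
    using edge_eq_iff[of 0 t] edge_eq_iff[of 1 t] that by auto
qed

lemma compact_drawing: "compact D"
  using compact_rest simple_path_edge by (simp add: drawing_eq compact_Un compact_simple_path_image)

lemma edge_in_drawing: "0 \<le> u \<Longrightarrow> u \<le> 1 \<Longrightarrow> g u \<in> D"
  by (auto simp: drawing_eq path_image_edge)

lemma compact_trimmed: "compact (trimmed s t)" if "s \<le> 1" "0 \<le> t"
  unfolding trimmed_def using that compact_rest
  by (intro compact_Un compact_simple_path_segment[OF simple_path_edge]) auto

lemma edge_in_trimmed_iff: "g u \<in> trimmed s t \<longleftrightarrow> u \<le> s \<or> t \<le> u"
  if "0 \<le> s" "s < t" "t \<le> 1" "0 \<le> u" "u \<le> 1"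
proof
  assume "g u \<in> trimmed s t"
  then consider "g u \<in> K" | v where "g u = g v" "0 \<le> v" "v \<le> s" | v where "g u = g v" "t \<le> v" "v \<le> 1"
    unfolding trimmed_def by auto
  then show "u \<le> s \<or> t \<le> u"
  proof cases
    case 1
    then show ?thesis using edge_notin_rest[of u] that by force
  next
    case 2
    then show ?thesis using edge_eq_iff[of v u] that by (cases "u = 0 \<or> u = 1") auto
  next
    case 3
    then show ?thesis using edge_eq_iff[of v u] that by (cases "u = 0 \<or> u = 1") auto
  qed
qed (use that in \<open>auto simp: trimmed_def\<close>)

lemma drawing_eq_trimmed_Un: "D = trimmed s t \<union> g ` {s..t}" if "0 \<le> s" "s \<le> t" "t \<le> 1"
proof -
  have "{0..1} = {0..s} \<union> {s..t} \<union> {t..1}" using that by auto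
  then show ?thesis unfolding drawing_eq path_image_edge trimmed_def by (metis Un_assoc Un_commute image_Un)
qed

lemma face_props:
  assumes "F \<in> components (- D)"
  shows "open F" "connected F" "F \<inter> D = {}" "frontier F \<subseteq> D" "F \<noteq> {}"
proof -
  have "open (- D)" using compact_drawing by (simp add: compact_imp_closed open_Compl)
  then show "open F" using assms open_components by blast
  show "connected F" using assms in_components_connected by blast
  show "F \<inter> D = {}" using assms in_components_subset by blast
  show "frontier F \<subseteq> D"
    using assms compact_drawing by (metis compact_imp_closed frontier_of_components_closed_complement)
  show "F \<noteq> {}" using assms in_components_nonempty by blast
qed

lemma edge_in_closure_iff_frontier: "0 \<le> u \<Longrightarrow> u \<le> 1 \<Longrightarrow> g u \<in> closure F \<longleftrightarrow> g u \<in> frontier F"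
  if "F \<in> components (- D)"
  using face_props[OF that] edge_in_drawing[of u] by (auto simp: frontier_def interior_open)

lemma frontier_open_segment:
  assumes F: "F \<in> components (- D)" and fr: "path_image g \<subseteq> frontier F"
    and st: "0 < s" "s < t" "t < 1"
  shows "frontier F - trimmed s t = g ` {s<..<t}"
proof (intro equalityI subsetI)
  fix x assume x: "x \<in> frontier F - trimmed s t"
  then have "x \<in> D" using face_props(4)[OF F] by auto
  then obtain u where "u \<in> {s..t}" "x = g u"
    using x drawing_eq_trimmed_Un[of s t] st by auto
  then show "x \<in> g ` {s<..<t}"
    using x edge_in_trimmed_iff[of s t u] st by auto
next
  fix x assume "x \<in> g ` {s<..<t}"
  then obtain u where u: "s < u" "u < t" "x = g u" by auto
  then have "x \<notin> trimmed s t" using edge_in_trimmed_iff[of s t u] st by auto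
  moreover have "x \<in> frontier F" using fr u st by (auto simp: path_image_edge)
  ultimately show "x \<in> frontier F - trimmed s t" by blast
qed

text \<open>If the edge bordered three faces, a chord \<open>\<gamma>\<close> through \<open>F2\<close> would join two of its points.
  \<open>F1\<close> and \<open>F3\<close> are joined outside \<open>\<gamma>\<close> and the middle of the edge (via a point near its end), and
  also outside \<open>\<gamma>\<close> and everything but the middle (via a point of the middle), so Janiszewski's
  theorem puts them in one component.\<close>

lemma edge_borders_at_most_two:
  assumes F: "F1 \<in> components (- D)" "F2 \<in> components (- D)" "F3 \<in> components (- D)"
    and fr: "path_image g \<subseteq> frontier F1" "path_image g \<subseteq> frontier F2" "path_image g \<subseteq> frontier F3"
    and ne: "F1 \<noteq> F2" "F3 \<noteq> F2"
  shows "F1 = F3"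
proof -
  define U where "U s t = frontier F2 - trimmed s t" for s t
  have opU: "openin (top_of_set (frontier F2)) (U s t)" if "s \<le> 1" "0 \<le> t" for s t
    unfolding U_def using compact_trimmed[OF that]
    by (metis Diff_eq compact_imp_closed open_Compl openin_open_Int)
  have U1: "U (1/5) (2/5) = g ` {1/5<..<2/5}" and U2: "U (3/5) (4/5) = g ` {3/5<..<4/5}"
    unfolding U_def by (rule frontier_open_segment[OF F(2) fr(2)]; simp)+
  have "g (3/10) \<in> U (1/5) (2/5)" "g (7/10) \<in> U (3/5) (4/5)"
    unfolding U1 U2 by simp_all
  moreover have "g (3/10) \<notin> U (3/5) (4/5)"
    unfolding U2
  proof
    assume "g (3/10) \<in> g ` {3/5<..<4/5}"
    then obtain v where "g v = g (3/10)" "3/5 < v" "v < 4/5" by auto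
    then show False using edge_eq_iff[of v "3/10"] by simp
  qed
  ultimately have "U (1/5) (2/5) \<noteq> {}" "U (3/5) (4/5) \<noteq> {}" "U (1/5) (2/5) \<noteq> U (3/5) (4/5)"
    by blast+
  moreover have "openin (top_of_set (frontier F2)) (U (1/5) (2/5))"
      "openin (top_of_set (frontier F2)) (U (3/5) (4/5))"
    by (rule opU; simp)+
  ultimately obtain \<gamma> where \<gamma>: "arc \<gamma>" "pathstart \<gamma> \<in> U (1/5) (2/5)" "pathfinish \<gamma> \<in> U (3/5) (4/5)"
      "\<gamma> ` {0<..<1} \<subseteq> F2"
    using dense_accessible_frontier_point_pairs[OF face_props(1,2)[OF F(2)]] by metis
  obtain s where s: "1/5 < s" "s < 2/5" "pathstart \<gamma> = g s"
    using \<gamma>(2) U1 by auto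
  obtain t where t: "3/5 < t" "t < 4/5" "pathfinish \<gamma> = g t"
    using \<gamma>(3) U2 by auto
  have \<gamma>_im: "path_image \<gamma> \<subseteq> F2 \<union> {g s, g t}"
  proof
    fix x assume "x \<in> path_image \<gamma>"
    then obtain v where v: "0 \<le> v" "v \<le> 1" "x = \<gamma> v" by (auto simp: path_image_def)
    then consider "v = 0" | "v = 1" | "v \<in> {0<..<1}" by force
    then show "x \<in> F2 \<union> {g s, g t}"
      using subsetD[OF \<gamma>(4), of "\<gamma> v"] s(3) t(3) v by cases (auto simp: pathstart_def pathfinish_def)
  qed
  have ends: "g s \<in> path_image \<gamma>" "g t \<in> path_image \<gamma>"
    using s(3) t(3) by (metis pathstart_in_path_image, metis pathfinish_in_path_image)
  define S where "S = g ` {s..t} \<union> path_image \<gamma>"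
  define T where "T = trimmed s t \<union> path_image \<gamma>"
  have D_eq: "D = trimmed s t \<union> g ` {s..t}"
    by (rule drawing_eq_trimmed_Un) (use s t in auto)
  have "g ` {s..t} \<inter> trimmed s t \<subseteq> {g s, g t}"
  proof
    fix x assume "x \<in> g ` {s..t} \<inter> trimmed s t"
    then obtain u where "s \<le> u" "u \<le> t" "x = g u" "g u \<in> trimmed s t" by auto
    then show "x \<in> {g s, g t}" using edge_in_trimmed_iff[of s t u] s t by force
  qed
  then have ST: "S \<inter> T = path_image \<gamma>"
    using ends by (auto simp: S_def T_def)
  have avoid: "F \<inter> path_image \<gamma> = {}" if "F \<in> components (- D)" "F \<noteq> F2" for F
    using components_nonoverlap[OF that(1) F(2)] that(2) face_props(3)[OF that(1)] \<gamma>_im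
      edge_in_drawing[of s] edge_in_drawing[of t] s t by auto
  have off: "g u \<notin> path_image \<gamma>" if "u \<noteq> s" "u \<noteq> t" "0 \<le> u" "u \<le> 1" for u
    using \<gamma>_im face_props(3)[OF F(2)] edge_in_drawing[OF that(3,4)] edge_eq_iff[of u s]
      edge_eq_iff[of u t] that s t by auto
  obtain x y where x: "x \<in> F1" and y: "y \<in> F3"
    using F in_components_nonempty by blast
  have cl: "g u \<in> closure F1" "g u \<in> closure F3" if "0 \<le> u" "u \<le> 1" for u
    using fr that by (auto simp: frontier_def path_image_edge image_subset_iff)
  have SD: "S \<subseteq> D \<union> path_image \<gamma>" and TD: "T \<subseteq> D \<union> path_image \<gamma>"
    using D_eq by (auto simp: S_def T_def)
  have out: "F1 \<subseteq> - S" "F3 \<subseteq> - S" "F1 \<subseteq> - T" "F3 \<subseteq> - T"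
    using SD TD face_props(3)[OF F(1)] face_props(3)[OF F(3)] avoid[OF F(1) ne(1)] avoid[OF F(3) ne(2)]
    by blast+
  have "g (1/10) \<notin> g ` {s..t}"
  proof
    assume "g (1/10) \<in> g ` {s..t}"
    then obtain v where "g v = g (1/10)" "s \<le> v" "v \<le> t" by auto
    then show False using edge_eq_iff[of v "1/10"] s t by simp
  qed
  then have "g (1/10) \<in> - S"
    using off[of "1/10"] s t by (auto simp: S_def)
  then have "connected_component (- S) x y"
    using connected_component_via_point[OF face_props(2)[OF F(1)] face_props(2)[OF F(3)] x y
        cl[of "1/10"] out(1,2)] by simp
  moreover have "g (1/2) \<in> - T"
    using off[of "1/2"] edge_in_trimmed_iff[of s t "1/2"] s t by (auto simp: T_def)
  then have "connected_component (- T) x y"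
    using connected_component_via_point[OF face_props(2)[OF F(1)] face_props(2)[OF F(3)] x y
        cl[of "1/2"] out(3,4)] by simp
  moreover have "compact (g ` {s..t})" "compact (trimmed s t)"
    by (rule compact_simple_path_segment[OF simple_path_edge] compact_trimmed; use s t in simp)+
  then have "compact S" "closed T" "connected (S \<inter> T)"
    unfolding ST unfolding S_def T_def
    using \<gamma>(1) by (simp_all add: compact_Un compact_imp_closed compact_arc_image connected_arc_image)
  ultimately have "connected_component (- (S \<union> T)) x y"
    using Janiszewski by blast
  moreover have "- (S \<union> T) \<subseteq> - D"
    using D_eq by (auto simp: S_def T_def)
  ultimately have "connected_component (- D) x y"
    using connected_component_of_subset by blast
  moreover have "F1 = connected_component_set (- D) x" "F3 = connected_component_set (- D) y"
    using x y F by (metis components_iff connected_component_eq)+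
  ultimately show ?thesis
    by (metis connected_component_eq mem_Collect_eq)
qed

text \<open>Suppose \<open>closure F'\<close> meets the edge but misses the piece between \<open>c\<close> and \<open>d\<close>.  Once this piece
  is deleted, the edge has a dangling end, which cannot separate \<open>F\<close> from \<open>F'\<close>; but the boundary
  of \<open>F'\<close> has not changed.\<close>

lemma face_touching_edge_gap:
  assumes F: "F \<in> components (- D)" "F' \<in> components (- D)" "F \<noteq> F'"
    and fr: "path_image g \<subseteq> closure F"
    and u: "0 < u" "u < c" "c < d" "d < 1" "g u \<in> closure F'"
    and gap: "g ` {c<..<d} \<inter> closure F' = {}"
  shows False
proof -
  define A where "A = path_image (subpath (u/2) c g)"
  define T where "T = trimmed (u/2) d"
  have A_eq: "A = g ` {u/2..c}"
    using u by (simp add: A_def path_image_subpath)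
  have "arc (subpath (u/2) c g)"
    using u edge_eq_iff[of "u/2" c] by (intro arc_simple_path_subpath simple_path_edge) auto
  then have A: "compact A" "connected (- A)"
    unfolding A_def by (auto intro: compact_arc_image connected_arc_complement)
  have T: "closed T"
    unfolding T_def by (intro compact_imp_closed compact_trimmed) (use u in auto)
  have "A \<inter> T = {g (u/2)}"
  proof
    show "A \<inter> T \<subseteq> {g (u/2)}"
    proof
      fix x assume "x \<in> A \<inter> T"
      then obtain v where "u/2 \<le> v" "v \<le> c" "x = g v" "g v \<in> trimmed (u/2) d"
        by (auto simp: A_eq T_def)
      then show "x \<in> {g (u/2)}" using edge_in_trimmed_iff[of "u/2" d v] u by force
    qed
    show "{g (u/2)} \<subseteq> A \<inter> T"
      using u by (auto simp: A_eq T_def trimmed_def)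
  qed
  then have conn: "connected (A \<inter> T)" by simp
  have AT: "A \<union> T = trimmed c d"
  proof -
    have "{0..c} = {0..u/2} \<union> {u/2..c}" using u by auto
    then show ?thesis unfolding A_eq T_def trimmed_def by (metis Un_assoc Un_commute image_Un)
  qed
  have ATD: "trimmed c d \<subseteq> D"
    using drawing_eq_trimmed_Un[of c d] u by auto
  obtain x y where x: "x \<in> F" and y: "y \<in> F'"
    using F face_props(5) by blast
  have xA: "x \<notin> A" "y \<notin> A"
    using face_props(3) F x y ATD AT by blast+
  then have "connected_component (- A) x y"
    using A(2) by (simp add: connected_iff_connected_component)
  moreover have "connected_component (- T) x y"
  proof (rule connected_component_via_point[OF face_props(2)[OF F(1)] face_props(2)[OF F(2)] x y])
    show "g u \<in> closure F" using fr u by (auto simp: path_image_edge)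
    show "g u \<in> closure F'" by fact
    show "g u \<in> - T" using edge_in_trimmed_iff[of "u/2" d u] u by (auto simp: T_def)
  qed (use face_props(3) F ATD AT in blast)+
  ultimately have "connected_component (- (A \<union> T)) x y"
    using Janiszewski[OF A(1) T conn] by blast
  then obtain C where C: "connected C" "C \<subseteq> - trimmed c d" "x \<in> C" "y \<in> C"
    unfolding AT connected_component_def by blast
  have "x \<notin> F'"
    using components_nonoverlap[OF F(1,2)] F(3) x by blast
  then have "C \<inter> frontier F' \<noteq> {}"
    using connected_Int_frontier[OF C(1), of F'] C(3,4) y by blast
  then obtain z where z: "z \<in> C" "z \<in> frontier F'" by blast
  then have "z \<in> D" "z \<notin> trimmed c d" using face_props(4)[OF F(2)] C(2) by blast+
  then obtain v where v: "z = g v" "c \<le> v" "v \<le> d"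
    using drawing_eq_trimmed_Un[of c d] u by auto
  then have "v \<in> {c<..<d}"
    using \<open>z \<notin> trimmed c d\<close> edge_in_trimmed_iff[of c d v] u by auto
  then have "z \<in> g ` {c<..<d}" using v(1) by blast
  then show False
    using gap z(2) by (auto simp: frontier_def)
qed

lemma drawn_edge_reversepath: "drawn_edge K D (reversepath g)"
proof (rule drawn_edge.intro)
  show "K \<inter> path_image (reversepath g) = {pathstart (reversepath g), pathfinish (reversepath g)}"
    using rest_Int_edge by (simp add: insert_commute)
  show "simple_path (reversepath g)"
    using simple_path_edge by (rule simple_path_reversepath)
  show "D = K \<union> path_image (reversepath g)"
    unfolding path_image_reversepath by (rule drawing_eq)
qed (rule compact_rest)

lemma edge_subset_closure_of_touching_face:
  assumes F: "F \<in> components (- D)" "F' \<in> components (- D)" "F \<noteq> F'"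
    and fr: "path_image g \<subseteq> closure F"
    and u: "0 < u" "u < 1" "g u \<in> closure F'"
  shows "path_image g \<subseteq> closure F'"
proof (rule ccontr)
  have contg: "continuous_on {0..1} g"
    using simple_path_edge by (simp add: simple_path_def path_def)
  define V where "V = {0..1} \<inter> g -` (- closure F')"
  assume "\<not> path_image g \<subseteq> closure F'"
  then have "V \<noteq> {}" by (auto simp: V_def path_image_edge)
  then obtain w0 where w0: "w0 \<in> V" by blast
  have "openin (top_of_set {0..1}) V"
    unfolding V_def using contg by (intro continuous_openin_preimage_gen) auto
  then obtain W where W: "open W" "V = {0..1} \<inter> W"
    by (auto simp: openin_open)
  then obtain \<epsilon> where \<epsilon>: "\<epsilon> > 0" "\<And>v. \<bar>v - w0\<bar> < \<epsilon> \<Longrightarrow> v \<in> W"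
    using w0 by (metis Int_iff open_real)
  have w01: "0 \<le> w0" "w0 \<le> 1" "w0 \<noteq> u"
    using w0 u(3) by (auto simp: V_def)
  define c0 where "c0 = max (max 0 (w0 - \<epsilon>)) (if w0 < u then 0 else u)"
  define d0 where "d0 = min (min 1 (w0 + \<epsilon>)) (if w0 < u then u else 1)"
  have "c0 < d0"
    using w01 \<epsilon>(1) u by (auto simp: c0_def d0_def)
  define c where "c = (2 * c0 + d0) / 3"
  define d where "d = (c0 + 2 * d0) / 3"
  have cd: "c0 < c" "c < d" "d < d0"
    using \<open>c0 < d0\<close> by (auto simp: c_def d_def)
  have cV: "v \<in> V" if "c \<le> v" "v \<le> d" for v
    using that cd \<epsilon>(2)[of v] unfolding W(2) c0_def d0_def by (auto simp: abs_less_iff)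
  then have gap: "g v \<notin> closure F'" if "c \<le> v" "v \<le> d" for v
    using that by (auto simp: V_def)
  show False
  proof (cases "w0 < u")
    case False
    then have "u < c" "d < 1" using cd by (auto simp: c0_def d0_def)
    then show False
      using face_touching_edge_gap[OF F fr u(1) \<open>u < c\<close> cd(2) \<open>d < 1\<close> u(3)] gap by force
  next
    case True
    then have "0 < c" "d < u" using cd by (auto simp: c0_def d0_def)
    interpret rev: drawn_edge K D "reversepath g"
      by (rule drawn_edge_reversepath)
    have "reversepath g ` {1 - d<..<1 - c} \<inter> closure F' = {}"
      using gap by (auto simp: reversepath_def)
    moreover have "path_image (reversepath g) \<subseteq> closure F" "reversepath g (1 - u) \<in> closure F'"
      using fr u by (simp, simp add: reversepath_def)
    ultimately show False
      using rev.face_touching_edge_gap[OF F, of "1 - u" "1 - d" "1 - c"] u \<open>0 < c\<close> \<open>d < u\<close> cd(2)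
      by linarith
  qed
qed

text \<open>A point \<open>x\<close> off the drawing, close to the edge but not in \<open>F\<close>, lies in another face; moving from
  \<open>x\<close> straight towards the edge shows that this face touches the edge.\<close>

lemma edge_borders_other_face:
  assumes F: "F \<in> components (- D)" and fr: "path_image g \<subseteq> frontier F"
    and T: "T \<inter> F = {}" "T \<inter> path_image g = {}" "g (1/2) \<in> closure T"
  obtains F' where "F' \<in> components (- D)" "F' \<noteq> F" "path_image g \<subseteq> frontier F'"
proof -
  have "g (1/2) \<notin> K" by (rule edge_notin_rest) auto
  then obtain \<epsilon> where \<epsilon>: "\<epsilon> > 0" "ball (g (1/2)) \<epsilon> \<subseteq> - K"
    using compact_rest by (metis ComplI compact_imp_closed open_Compl openE)
  obtain x where x: "x \<in> T" "x \<in> ball (g (1/2)) \<epsilon>"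
    using T(3) \<epsilon>(1) by (metis closure_approachable dist_commute mem_ball)
  let ?L = "closed_segment x (g (1/2))"
  have L: "?L \<subseteq> ball (g (1/2)) \<epsilon>"
    using x(2) \<epsilon>(1) by (intro closed_segment_subset) auto
  have "x \<notin> D"
    using x T(2) \<epsilon>(2) by (auto simp: drawing_eq)
  then obtain F' where F': "F' \<in> components (- D)" "x \<in> F'"
    by (metis ComplI UnionE Union_components)
  have "F' \<noteq> F" using F' x T(1) by auto
  have "g (1/2) \<notin> F'"
    using face_props(3)[OF F'(1)] edge_in_drawing[of "1/2"] by auto
  then have "?L \<inter> frontier F' \<noteq> {}"
    using F'(2) by (intro connected_Int_frontier) auto
  then obtain z where z: "z \<in> ?L" "z \<in> frontier F'" by blast
  then have "z \<in> D" "z \<notin> K"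
    using face_props(4)[OF F'(1)] L \<epsilon>(2) by auto
  then obtain u where u: "z = g u" "0 \<le> u" "u \<le> 1"
    by (auto simp: drawing_eq path_image_edge)
  then have "u \<noteq> 0" "u \<noteq> 1"
    using \<open>z \<notin> K\<close> rest_Int_edge by (auto simp: pathstart_def pathfinish_def)
  then have "path_image g \<subseteq> closure F'"
    using edge_subset_closure_of_touching_face[OF F F'(1) \<open>F' \<noteq> F\<close>[symmetric], of u] fr u z(2)
    by (auto simp: frontier_def)
  then have "path_image g \<subseteq> frontier F'"
    using edge_in_closure_iff_frontier[OF F'(1)] by (auto simp: path_image_edge)
  then show thesis using that F'(1) \<open>F' \<noteq> F\<close> by blast
qed

end

section \<open>The weak dual of a plane graph whose interior faces are bounded by cycles\<close>

context
  fixes H :: plane_drawing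
  assumes H: "plane_graph H"
begin

lemma edges_Int_subset_verts: "e \<in> pedges H \<Longrightarrow> e' \<in> pedges H \<Longrightarrow> e \<noteq> e' \<Longrightarrow> e \<inter> e' \<subseteq> pverts H"
  using H by (auto simp: plane_graph_def)

lemma drawn_edge_of_plane_graph:
  assumes e: "e \<in> pedges H"
  obtains g where "drawn_edge (pverts H \<union> \<Union> (pedges H - {e})) (pverts H \<union> \<Union> (pedges H)) g"
    "path_image g = e"
proof -
  obtain g where g: "simple_path g" "path_image g = e" "e \<inter> pverts H = {pathstart g, pathfinish g}"
    using H e by (auto simp: plane_graph_def)
  have "compact e'" if "e' \<in> pedges H" for e'
    using H that by (metis plane_graph_def compact_simple_path_image)
  then have "compact (\<Union> (pedges H - {e}))" "compact (pverts H)"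
    using H by (auto simp: plane_graph_def intro: compact_Union finite_imp_compact)
  then have "drawn_edge (pverts H \<union> \<Union> (pedges H - {e})) (pverts H \<union> \<Union> (pedges H)) g"
    using g edges_Int_subset_verts[OF e] e by unfold_locales (blast intro: compact_Un)+
  then show thesis using that g(2) by blast
qed

lemma arc_of_edge:
  assumes "e \<in> pedges H" "edge_ends H e = {a, b}" "a \<noteq> b"
  obtains g where "arc g" "pathstart g = a" "pathfinish g = b" "path_image g = e"
proof -
  obtain g where g: "simple_path g" "path_image g = e" "e \<inter> pverts H = {pathstart g, pathfinish g}"
    using H assms(1) by (auto simp: plane_graph_def)
  then consider "pathstart g = a" "pathfinish g = b" | "pathstart g = b" "pathfinish g = a"
    using assms(2) by (auto simp: edge_ends_def doubleton_eq_iff)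
  then show thesis
  proof cases
    case 1
    then show thesis using that g assms(3) simple_path_imp_arc by metis
  next
    case 2
    then have "arc (reversepath g)"
      using g(1) assms(3) simple_path_imp_arc arc_reversepath by metis
    then show thesis
      using that[of "reversepath g"] 2 g(2) by simp
  qed
qed

lemma arc_of_walk:
  assumes "es \<noteq> []" "length vs = Suc (length es)" "distinct vs" "distinct es" "set es \<subseteq> pedges H"
    "\<forall>i < length es. edge_ends H (es ! i) = {vs ! i, vs ! Suc i}"
  shows "\<exists>g. arc g \<and> pathstart g = hd vs \<and> pathfinish g = last vs \<and> path_image g = \<Union> (set es)"
  using assms
proof (induction es arbitrary: vs)
  case Nil
  then show ?case by simp
next
  case (Cons e es)
  obtain v w us where vs: "vs = v # w # us"
    using Cons.prems(2) by (auto simp: length_Suc_conv)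
  have "edge_ends H e = {v, w}" "v \<noteq> w"
    using Cons.prems(3,6) vs by auto
  then obtain g where g: "arc g" "pathstart g = v" "pathfinish g = w" "path_image g = e"
    using arc_of_edge[of e v w] Cons.prems(5) by auto
  show ?case
  proof (cases "es = []")
    case True
    then have "us = []" using Cons.prems(2) vs by simp
    then show ?thesis using g vs True by auto
  next
    case False
    have ends: "edge_ends H (es ! i) = {(w # us) ! i, (w # us) ! Suc i}" if "i < length es" for i
      using Cons.prems(6) that vs by (metis length_Cons Suc_less_eq nth_Cons_Suc)
    then obtain h where h: "arc h" "pathstart h = w" "pathfinish h = last (w # us)" "path_image h = \<Union> (set es)"
      using Cons.IH[of "w # us"] False Cons.prems vs by auto
    have "v \<notin> e'" if e': "e' \<in> set es" for e'
    proof
      assume "v \<in> e'"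
      obtain i where i: "i < length es" "e' = es ! i"
        using e' by (auto simp: in_set_conv_nth)
      have "v \<in> pverts H" using \<open>edge_ends H e = {v, w}\<close> by (auto simp: edge_ends_def)
      then have "v \<in> {(w # us) ! i, (w # us) ! Suc i}"
        using ends[OF i(1)] i(2) \<open>v \<in> e'\<close> by (auto simp: edge_ends_def)
      moreover have "Suc i < length (w # us)" using i(1) Cons.prems(2) vs by simp
      ultimately have "v \<in> set (w # us)" by (metis Suc_lessD insert_iff nth_mem singletonD)
      then show False using Cons.prems(3) vs by simp
    qed
    moreover have "e \<inter> \<Union> (set es) \<subseteq> {v, w}"
      using edges_Int_subset_verts[of e] Cons.prems(4,5) \<open>edge_ends H e = {v, w}\<close>
      by (fastforce simp: edge_ends_def)
    ultimately have "arc (g +++ h)"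
      using g h by (intro arc_join) auto
    then show ?thesis
      using g h vs by (intro exI[of _ "g +++ h"]) (simp add: path_image_join)
  qed
qed

lemma cycle_imp_closed_simple_path:
  assumes "is_cycle H Z"
  obtains c where "simple_path c" "pathfinish c = pathstart c" "path_image c = \<Union> Z"
proof -
  obtain vs es where c: "distinct vs" "distinct es" "es \<noteq> []" "length vs = length es"
      "set vs \<subseteq> pverts H" "set es \<subseteq> pedges H" "Z = set es"
      "\<And>i. i < length es \<Longrightarrow> edge_ends H (es ! i) = {vs ! i, vs ! (Suc i mod length es)}"
    using assms by (auto simp: is_cycle_def)
  obtain es' e where es: "es = es' @ [e]"
    using c(3) by (metis rev_exhaust)
  have e: "e \<in> pedges H" using c(6) es by simp
  have vs: "vs \<noteq> []" using c(3,4) by auto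
  have "edge_ends H e = {vs ! length es', vs ! 0}"
    using c(8)[of "length es'"] es by simp
  then have e_ends: "edge_ends H e = {last vs, hd vs}"
    using c(4) es vs by (simp add: last_conv_nth hd_conv_nth)
  show thesis
  proof (cases "es' = []")
    case True
    then have "last vs = hd vs"
      using c(4) es by (metis append_Nil last_ConsL length_0_conv length_Suc_conv list.sel(1) list.size(3,4) One_nat_def Suc_eq_plus1)
    moreover obtain g where "simple_path g" "path_image g = e" "e \<inter> pverts H = {pathstart g, pathfinish g}"
      using H e by (auto simp: plane_graph_def)
    ultimately show thesis
      using that[of g] e_ends c(7) es True by (auto simp: edge_ends_def)
  next
    case False
    have "edge_ends H (es' ! i) = {vs ! i, vs ! Suc i}" if "i < length es'" for i
      using c(8)[of i] that es by (simp add: nth_append)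
    then obtain g where g: "arc g" "pathstart g = hd vs" "pathfinish g = last vs" "path_image g = \<Union> (set es')"
      using arc_of_walk[of es' vs] False c es by auto
    then have "last vs \<noteq> hd vs" using arc_distinct_ends by metis
    then obtain h where h: "arc h" "pathstart h = last vs" "pathfinish h = hd vs" "path_image h = e"
      using arc_of_edge[OF e e_ends] by blast
    have "\<Union> (set es') \<inter> e \<subseteq> {hd vs, last vs}"
      using edges_Int_subset_verts[OF e] c(2,6) es e_ends by (fastforce simp: edge_ends_def)
    then have "simple_path (g +++ h)"
      using g h by (intro simple_path_join_loop) auto
    then show thesis
      using that[of "g +++ h"] g h c(7) es by (simp add: path_image_join Un_commute)
  qed
qed

lemma edge_subset_Union_edges_iff:
  assumes "Z \<subseteq> pedges H" "e \<in> pedges H"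
  shows "e \<subseteq> \<Union> Z \<longleftrightarrow> e \<in> Z"
proof
  assume sub: "e \<subseteq> \<Union> Z"
  obtain g where g: "drawn_edge (pverts H \<union> \<Union> (pedges H - {e})) (pverts H \<union> \<Union> (pedges H)) g"
      "path_image g = e"
    using drawn_edge_of_plane_graph[OF assms(2)] by blast
  then have "g (1/2) \<notin> \<Union> (pedges H - {e})" "g (1/2) \<in> e"
    using drawn_edge.edge_notin_rest[OF g(1), of "1/2"] by (auto simp: path_image_def)
  then show "e \<in> Z" using sub assms(1) by blast
qed auto

lemma bounded_by_cycle_iff_eq:
  assumes "bounded_by_cycle H F Z"
  shows "Z = {e \<in> pedges H. e \<subseteq> frontier F}"
proof -
  have Z: "Z \<subseteq> pedges H" "\<Union> Z = frontier F"
    using assms by (auto simp: bounded_by_cycle_def is_cycle_def)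
  show ?thesis
    using edge_subset_Union_edges_iff[OF Z(1)] Z(1) unfolding Z(2) by (intro equalityI subsetI) auto
qed

lemma bounding_cycle_eq:
  assumes "\<exists>Z. bounded_by_cycle H F Z"
  shows "bounding_cycle H F = {e \<in> pedges H. e \<subseteq> frontier F}"
proof -
  obtain Z where Z: "bounded_by_cycle H F Z" using assms by blast
  have "Z' = Z" if "bounded_by_cycle H F Z'" for Z'
    by (rule trans[OF bounded_by_cycle_iff_eq[OF that] bounded_by_cycle_iff_eq[OF Z, symmetric]])
  with Z have "bounding_cycle H F = Z"
    unfolding bounding_cycle_def by (intro the_equality)
  then show ?thesis by (rule trans[OF _ bounded_by_cycle_iff_eq[OF Z]])
qed

lemma edge_borders_at_most_two_faces:
  assumes "e \<in> pedges H" "F1 \<in> faces H" "F2 \<in> faces H" "F3 \<in> faces H"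
    "e \<subseteq> frontier F1" "e \<subseteq> frontier F2" "e \<subseteq> frontier F3" "F1 \<noteq> F2"
  shows "F3 \<in> {F1, F2}"
proof -
  obtain g where g: "drawn_edge (pverts H \<union> \<Union> (pedges H - {e})) (pverts H \<union> \<Union> (pedges H)) g"
      "path_image g = e"
    using drawn_edge_of_plane_graph[OF assms(1)] by blast
  have "F1 = F3" if "F3 \<noteq> F2"
    using drawn_edge.edge_borders_at_most_two[OF g(1) assms(2-4)[unfolded faces_def]
        assms(5-7)[folded g(2)] assms(8) that] .
  then show ?thesis by blast
qed

lemma cycle_edge_borders_other_face:
  assumes F: "F \<in> faces H" and Z: "bounded_by_cycle H F Z" and e: "e \<in> Z"
  obtains F' where "F' \<in> faces H" "F' \<noteq> F" "e \<subseteq> frontier F'"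
proof -
  have ZH: "Z \<subseteq> pedges H" "\<Union> Z = frontier F"
    using Z by (auto simp: bounded_by_cycle_def is_cycle_def)
  then have eH: "e \<in> pedges H" using e by auto
  obtain c where c: "simple_path c" "pathfinish c = pathstart c" "path_image c = \<Union> Z"
    using cycle_imp_closed_simple_path Z bounded_by_cycle_def by metis
  obtain g where g: "drawn_edge (pverts H \<union> \<Union> (pedges H - {e})) (pverts H \<union> \<Union> (pedges H)) g"
      "path_image g = e"
    using drawn_edge_of_plane_graph[OF eH] by blast
  interpret drawn_edge "pverts H \<union> \<Union> (pedges H - {e})" "pverts H \<union> \<Union> (pedges H)" g
    by (rule g(1))
  have F': "F \<in> components (- (pverts H \<union> \<Union> (pedges H)))" using F by (simp add: faces_def)
  note J = Jordan_inside_outside[OF c(1,2), unfolded c(3)]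
  have "F \<inter> \<Union> Z = {}" using face_props(3)[OF F'] ZH(1) by blast
  moreover have "frontier (inside (\<Union> Z)) = \<Union> Z" using J by simp
  ultimately have "F \<inter> inside (\<Union> Z) = {} \<or> F - inside (\<Union> Z) = {}"
    using connected_Int_frontier[OF face_props(2)[OF F'], of "inside (\<Union> Z)"] by metis
  moreover have "inside (\<Union> Z) \<inter> outside (\<Union> Z) = {}" by (rule inside_Int_outside)
  ultimately obtain T where T: "T \<in> {inside (\<Union> Z), outside (\<Union> Z)}" "T \<inter> F = {}"
    by blast
  have "T \<inter> \<Union> Z = {}"
    using T(1) by (elim insertE) (simp_all only: inside_no_overlap outside_no_overlap empty_iff)
  then have "T \<inter> path_image g = {}" using e g(2) by blast
  moreover have "frontier T = \<Union> Z" using T(1) J by auto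
  moreover have "g (1/2) \<in> e"
    unfolding g(2)[symmetric] by (simp add: path_image_def)
  then have "g (1/2) \<in> \<Union> Z" using e by blast
  ultimately have "g (1/2) \<in> closure T" "T \<inter> path_image g = {}"
    by (auto simp: frontier_def)
  moreover have "path_image g \<subseteq> frontier F" using g(2) e ZH(2) by blast
  ultimately show thesis
    using edge_borders_other_face[OF F', of T] T(2) that g(2) by (auto simp: faces_def)
qed

lemma adjacency_matrix_weak_dual:
  assumes fs: "distinct fs" "set fs \<subseteq> interior_faces H"
    and cyc: "\<And>F. F \<in> interior_faces H \<Longrightarrow> \<exists>Z. bounded_by_cycle H F Z"
    and ij: "i < length fs" "j < length fs"
  shows "adjacency_matrix (weak_dual H) fs $$ (i, j) =
    (if i = j then 0 else card (bounding_cycle H (fs ! i) \<inter> bounding_cycle H (fs ! j)))"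
proof -
  have F: "F \<in> faces H" "F \<noteq> outer_face H" if "F \<in> interior_faces H" for F
    using that by (auto simp: interior_faces_def)
  have fi: "fs ! i \<in> interior_faces H" "fs ! j \<in> interior_faces H"
    using fs(2) ij nth_mem by auto
  let ?ends = "\<lambda>e. {F \<in> faces H. e \<subseteq> frontier F}"
  have adj: "adjacency_matrix (weak_dual H) fs $$ (i, j) =
      card {e \<in> pedges H. outer_face H \<notin> ?ends e \<and> ?ends e = {fs ! i, fs ! j}}"
    using ij by (simp add: adjacency_matrix_def weak_dual_def delete_vertex_def dual_graph_def)
  show ?thesis
  proof (cases "i = j")
    case True
    have "\<not> (e \<in> pedges H \<and> ?ends e = {fs ! i})" for e
    proof
      assume e: "e \<in> pedges H \<and> ?ends e = {fs ! i}"
      obtain Z where Z: "bounded_by_cycle H (fs ! i) Z" using cyc fi by blast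
      have "e \<subseteq> frontier (fs ! i)" using e by auto
      then have "e \<in> Z" unfolding bounded_by_cycle_iff_eq[OF Z] using e by simp
      then obtain F' where "F' \<in> faces H" "F' \<noteq> fs ! i" "e \<subseteq> frontier F'"
        by (rule cycle_edge_borders_other_face[OF F(1)[OF fi(1)] Z])
      then have "F' \<in> ?ends e" by simp
      then show False using e \<open>F' \<noteq> fs ! i\<close> by simp
    qed
    then have "{e \<in> pedges H. outer_face H \<notin> ?ends e \<and> ?ends e = {fs ! i, fs ! j}} = {}"
      unfolding True insert_absorb2 by blast
    then show ?thesis unfolding adj if_P[OF True] by (simp only: card.empty)
  next
    case False
    then have ne: "fs ! i \<noteq> fs ! j" using fs(1) ij by (simp add: nth_eq_iff_index_eq)
    have "{e \<in> pedges H. outer_face H \<notin> ?ends e \<and> ?ends e = {fs ! i, fs ! j}} =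
        bounding_cycle H (fs ! i) \<inter> bounding_cycle H (fs ! j)"
      (is "?L = ?R")
    proof (intro equalityI subsetI)
      fix e assume "e \<in> ?L"
      then have "e \<in> pedges H" "fs ! i \<in> ?ends e \<and> fs ! j \<in> ?ends e" by blast+
      then show "e \<in> ?R"
        unfolding bounding_cycle_eq[OF cyc[OF fi(1)]] bounding_cycle_eq[OF cyc[OF fi(2)]] by simp
    next
      fix e assume "e \<in> ?R"
      then have e: "e \<in> pedges H" "e \<subseteq> frontier (fs ! i)" "e \<subseteq> frontier (fs ! j)"
        unfolding bounding_cycle_eq[OF cyc[OF fi(1)]] bounding_cycle_eq[OF cyc[OF fi(2)]] by simp_all
      have "?ends e = {fs ! i, fs ! j}"
      proof
        show "?ends e \<subseteq> {fs ! i, fs ! j}"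
        proof
          fix F' assume "F' \<in> ?ends e"
          then have "F' \<in> faces H" "e \<subseteq> frontier F'" by simp_all
          then show "F' \<in> {fs ! i, fs ! j}"
            using edge_borders_at_most_two_faces[OF e(1) F(1)[OF fi(1)] F(1)[OF fi(2)] _ e(2,3) _ ne]
            by simp
        qed
      qed (use e F(1)[OF fi(1)] F(1)[OF fi(2)] in simp)
      moreover have "outer_face H \<notin> {fs ! i, fs ! j}"
        using F(2)[OF fi(1)] F(2)[OF fi(2)] by simp
      ultimately have "outer_face H \<notin> ?ends e" by blast
      with \<open>?ends e = {fs ! i, fs ! j}\<close> show "e \<in> ?L"
        using e(1) by blast
    qed
    then show ?thesis unfolding adj if_not_P[OF False] by (simp only:)
  qed
qed

end

section \<open>Existence of the Smith normal form over the integers\<close>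

definition unimodular :: "nat \<Rightarrow> int mat \<Rightarrow> bool" where
  "unimodular n P \<longleftrightarrow> P \<in> carrier_mat n n \<and>
     (\<exists>P' \<in> carrier_mat n n. P * P' = 1\<^sub>m n \<and> P' * P = 1\<^sub>m n)"

definition unimodular_equiv :: "nat \<Rightarrow> int mat \<Rightarrow> int mat \<Rightarrow> bool" where
  "unimodular_equiv n A B \<longleftrightarrow> (\<exists>P Q. unimodular n P \<and> unimodular n Q \<and> B = P * A * Q)"

lemma unimodularI:
  "P \<in> carrier_mat n n \<Longrightarrow> P' \<in> carrier_mat n n \<Longrightarrow> P * P' = 1\<^sub>m n \<Longrightarrow> P' * P = 1\<^sub>m n \<Longrightarrow> unimodular n P"
  by (auto simp: unimodular_def)

lemma unimodular_carrier: "unimodular n P \<Longrightarrow> P \<in> carrier_mat n n"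
  by (simp add: unimodular_def)

lemma unimodular_imp_invertible_mat: "unimodular n P \<Longrightarrow> invertible_mat P"
  by (auto simp: unimodular_def invertible_mat_def inverts_mat_def square_mat.simps)

lemma unimodular_one: "unimodular n (1\<^sub>m n)"
  by (rule unimodularI[of _ _ "1\<^sub>m n"]) auto

lemma unimodular_uminus_one: "unimodular n (- 1\<^sub>m n)"
  by (rule unimodularI[of _ _ "- 1\<^sub>m n"]) auto

lemma unimodular_mult:
  assumes "unimodular n P" "unimodular n Q"
  shows "unimodular n (P * Q)"
proof -
  obtain P' Q' where P: "P \<in> carrier_mat n n" "P' \<in> carrier_mat n n" "P * P' = 1\<^sub>m n" "P' * P = 1\<^sub>m n"
    and Q: "Q \<in> carrier_mat n n" "Q' \<in> carrier_mat n n" "Q * Q' = 1\<^sub>m n" "Q' * Q = 1\<^sub>m n"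
    using assms by (auto simp: unimodular_def)
  have "P * Q * (Q' * P') = P * (Q * Q') * P'" "Q' * P' * (P * Q) = Q' * (P' * P) * Q"
    using P(1,2) Q(1,2) by (simp_all add: assoc_mult_mat[of _ n n _ n _ n])
  then show ?thesis
    using P Q by (intro unimodularI[of _ _ "Q' * P'"]) simp_all
qed

lemma unimodular_addrow_mat:
  assumes "k < n" "l < n" "k \<noteq> l"
  shows "unimodular n (addrow_mat n a k l)"
  using addrow_mat_inv[OF assms, of a] addrow_mat_inv[OF assms, of "- a"]
  by (intro unimodularI[of _ _ "addrow_mat n (- a) k l"]) simp_all

lemma unimodular_swaprows_mat:
  assumes "k < n" "l < n"
  shows "unimodular n (swaprows_mat n k l)"
  using swaprows_mat_inv[OF assms] by (intro unimodularI[of _ _ "swaprows_mat n k l"]) simp_all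

lemma unimodular_four_block_diag:
  assumes "unimodular n P"
  shows "unimodular (Suc n) (four_block_mat (1\<^sub>m 1) (0\<^sub>m 1 n) (0\<^sub>m n 1) P)"
proof -
  obtain P' where P: "P \<in> carrier_mat n n" "P' \<in> carrier_mat n n" "P * P' = 1\<^sub>m n" "P' * P = 1\<^sub>m n"
    using assms by (auto simp: unimodular_def)
  show ?thesis
    by (rule unimodularI[of _ _ "four_block_mat (1\<^sub>m 1) (0\<^sub>m 1 n) (0\<^sub>m n 1) P'"])
      (use P in \<open>simp_all add: mult_four_block_mat[of _ 1 1 _ n _ n _ _ 1 _ n]
        four_block_carrier_mat[of _ 1 1 _ n n, simplified]\<close>)
qed

lemma uminus_zero_mat: "- 0\<^sub>m a b = (0\<^sub>m a b :: int mat)"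
  by (rule eq_matI) auto

lemma unimodular_four_block_lower:
  assumes V: "V \<in> carrier_mat n 1"
  shows "unimodular (Suc n) (four_block_mat (1\<^sub>m 1) (0\<^sub>m 1 n) V (1\<^sub>m n))"
proof -
  have inv: "V + - V = 0\<^sub>m n 1" "- V + V = 0\<^sub>m n 1"
    using V by (auto intro!: eq_matI)
  show ?thesis
    by (rule unimodularI[of _ _ "four_block_mat (1\<^sub>m 1) (0\<^sub>m 1 n) (- V) (1\<^sub>m n)"])
      (use V in \<open>simp_all add: mult_four_block_mat[of _ 1 1 _ n _ n _ _ 1 _ n]
        four_block_carrier_mat[of _ 1 1 _ n n, simplified] inv uminus_zero_mat\<close>)
qed

lemma unimodular_four_block_upper:
  assumes W: "W \<in> carrier_mat 1 n"
  shows "unimodular (Suc n) (four_block_mat (1\<^sub>m 1) W (0\<^sub>m n 1) (1\<^sub>m n))"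
proof -
  have inv: "W + - W = 0\<^sub>m 1 n" "- W + W = 0\<^sub>m 1 n"
    using W by (auto intro!: eq_matI)
  show ?thesis
    by (rule unimodularI[of _ _ "four_block_mat (1\<^sub>m 1) (- W) (0\<^sub>m n 1) (1\<^sub>m n)"])
      (use W in \<open>simp_all add: mult_four_block_mat[of _ 1 1 _ n _ n _ _ 1 _ n]
        four_block_carrier_mat[of _ 1 1 _ n n, simplified] inv uminus_zero_mat\<close>)
qed

lemma unimodular_equivI:
  "unimodular n P \<Longrightarrow> unimodular n Q \<Longrightarrow> unimodular_equiv n A (P * A * Q)"
  by (auto simp: unimodular_equiv_def)

lemma unimodular_equiv_carrier:
  "unimodular_equiv n A B \<Longrightarrow> A \<in> carrier_mat n n \<Longrightarrow> B \<in> carrier_mat n n"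
  by (auto simp: unimodular_equiv_def dest!: unimodular_carrier)

lemma unimodular_equiv_left:
  "unimodular n P \<Longrightarrow> A \<in> carrier_mat n n \<Longrightarrow> unimodular_equiv n A (P * A)"
  unfolding unimodular_equiv_def
  by (intro exI[of _ P] exI[of _ "1\<^sub>m n"]) (auto simp: unimodular_one dest!: unimodular_carrier)

lemma unimodular_equiv_right:
  "unimodular n Q \<Longrightarrow> A \<in> carrier_mat n n \<Longrightarrow> unimodular_equiv n A (A * Q)"
  unfolding unimodular_equiv_def
  by (intro exI[of _ "1\<^sub>m n"] exI[of _ Q]) (auto simp: unimodular_one dest!: unimodular_carrier)

lemma unimodular_equiv_refl: "A \<in> carrier_mat n n \<Longrightarrow> unimodular_equiv n A A"
  using unimodular_equiv_left[OF unimodular_one, of A n] by simp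

lemma unimodular_equiv_trans:
  assumes "unimodular_equiv n A B" "unimodular_equiv n B C" "A \<in> carrier_mat n n"
  shows "unimodular_equiv n A C"
proof -
  obtain P Q P' Q' where u: "unimodular n P" "unimodular n Q" "B = P * A * Q"
      "unimodular n P'" "unimodular n Q'" "C = P' * B * Q'"
    using assms(1,2) by (auto simp: unimodular_equiv_def)
  then have "C = (P' * P) * A * (Q * Q')"
    using assms(3) u(1,2,4,5)[THEN unimodular_carrier]
    by (simp add: assoc_mult_mat[of _ n n _ n _ n])
  then show ?thesis
    using unimodular_mult u unfolding unimodular_equiv_def by blast
qed

text \<open>Minimality is over all matrices equivalent to \<open>A\<close>, so division with remainder by an entry \<open>d\<close>
  in its row or column leaves no remainder.\<close>

definition least_entry :: "nat \<Rightarrow> int mat \<Rightarrow> int \<Rightarrow> bool" where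
  "least_entry n A d \<longleftrightarrow> 0 < d \<and> (\<forall>B i j. unimodular_equiv n A B \<longrightarrow> i < n \<longrightarrow> j < n \<longrightarrow>
     B $$ (i, j) \<noteq> 0 \<longrightarrow> d \<le> \<bar>B $$ (i, j)\<bar>)"

lemma least_entry_dvd_col:
  assumes A: "A \<in> carrier_mat n n" and d: "least_entry n A d"
    and B: "unimodular_equiv n A B" "B $$ (0, 0) = d" and i: "i < n"
  shows "d dvd B $$ (i, 0)"
proof (cases "i = 0")
  case False
  have Bc: "B \<in> carrier_mat n n" using unimodular_equiv_carrier[OF B(1) A] .
  define q where "q = - (B $$ (i, 0) div d)"
  have "unimodular_equiv n A (addrow_mat n q i 0 * B)"
    using unimodular_equiv_trans[OF B(1) unimodular_equiv_left A] unimodular_addrow_mat[of i n 0] Bc i False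
    by simp
  moreover have "(addrow_mat n q i 0 * B) $$ (i, 0) = B $$ (i, 0) mod d"
    using i Bc B(2) unfolding addrow_mat[OF Bc, of 0 q i, symmetric, OF le_less_trans[OF le0 i]]
    by (simp add: q_def minus_div_mult_eq_mod [symmetric])
  ultimately have "B $$ (i, 0) mod d = 0 \<or> d \<le> \<bar>B $$ (i, 0) mod d\<bar>"
    using d i by (metis least_entry_def less_nat_zero_code neq0_conv)
  moreover have "0 \<le> B $$ (i, 0) mod d" "B $$ (i, 0) mod d < d"
    using d by (auto simp: least_entry_def)
  ultimately show ?thesis by auto
qed (use B in simp)

lemma least_entry_dvd_row:
  assumes A: "A \<in> carrier_mat n n" and d: "least_entry n A d"
    and B: "unimodular_equiv n A B" "B $$ (0, 0) = d" and j: "j < n"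
  shows "d dvd B $$ (0, j)"
proof (cases "j = 0")
  case False
  have Bc: "B \<in> carrier_mat n n" using unimodular_equiv_carrier[OF B(1) A] .
  define q where "q = - (B $$ (0, j) div d)"
  have "unimodular_equiv n A (B * addrow_mat n q 0 j)"
    using unimodular_equiv_trans[OF B(1) unimodular_equiv_right A] unimodular_addrow_mat[of 0 n j] Bc j False
    by simp
  moreover have "(B * addrow_mat n q 0 j) $$ (0, j) = B $$ (0, j) mod d"
    using j Bc B(2) unfolding addcol_mat[OF Bc, of 0 q j, symmetric, OF le_less_trans[OF le0 j]]
    by (simp add: q_def minus_div_mult_eq_mod [symmetric])
  ultimately have "B $$ (0, j) mod d = 0 \<or> d \<le> \<bar>B $$ (0, j) mod d\<bar>"
    using d j by (metis least_entry_def less_nat_zero_code neq0_conv)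
  moreover have "0 \<le> B $$ (0, j) mod d" "B $$ (0, j) mod d < d"
    using d by (auto simp: least_entry_def)
  ultimately show ?thesis by auto
qed (use B in simp)

lemma least_entry_dvd_all:
  assumes A: "A \<in> carrier_mat n n" and d: "least_entry n A d"
    and B: "unimodular_equiv n A B" "B $$ (0, 0) = d" and i: "i < n" and j: "j < n"
    and col0: "B $$ (i, 0) = 0"
  shows "d dvd B $$ (i, j)"
proof (cases "i = 0")
  case False
  have Bc: "B \<in> carrier_mat n n" using unimodular_equiv_carrier[OF B(1) A] .
  let ?B = "addrow_mat n 1 0 i * B"
  have "unimodular_equiv n A ?B"
    using unimodular_equiv_trans[OF B(1) unimodular_equiv_left A] unimodular_addrow_mat[of 0 n i] Bc i False
    by simp
  moreover have "?B $$ (0, k) = B $$ (i, k) + B $$ (0, k)" if "k < n" for k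
    using i Bc that unfolding addrow_mat[OF Bc i, of 1 0, symmetric] by simp
  ultimately have "d dvd B $$ (i, j) + B $$ (0, j)"
    using least_entry_dvd_row[OF A d, of ?B j] B(2) col0 i j by simp
  then show ?thesis
    using least_entry_dvd_row[OF A d B j] by (simp add: dvd_add_left_iff)
qed (use least_entry_dvd_row[OF A d B j] in simp)

lemma least_entry_exists:
  assumes A: "A \<in> carrier_mat n n" and nz: "A \<noteq> 0\<^sub>m n n"
  obtains d B where "least_entry n A d" "unimodular_equiv n A B" "B $$ (0, 0) = d"
proof -
  define E where "E = {m. \<exists>B i j. unimodular_equiv n A B \<and> i < n \<and> j < n \<and> B $$ (i, j) \<noteq> 0 \<and> m = nat \<bar>B $$ (i, j)\<bar>}"
  obtain i j where "i < n" "j < n" "A $$ (i, j) \<noteq> 0"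
    using A nz by (metis carrier_matD eq_matI index_zero_mat)
  then have "nat \<bar>A $$ (i, j)\<bar> \<in> E"
    unfolding E_def using unimodular_equiv_refl[OF A] by blast
  then have L: "(LEAST m. m \<in> E) \<in> E" by (rule LeastI)
  define d where "d = int (LEAST m. m \<in> E)"
  obtain B i j where B: "unimodular_equiv n A B" "i < n" "j < n" "B $$ (i, j) \<noteq> 0" "d = \<bar>B $$ (i, j)\<bar>"
    using L unfolding d_def E_def by auto
  have "d \<le> \<bar>C $$ (k, l)\<bar>" if "unimodular_equiv n A C" "k < n" "l < n" "C $$ (k, l) \<noteq> 0" for C k l
  proof -
    have "nat \<bar>C $$ (k, l)\<bar> \<in> E" using that by (auto simp: E_def)
    then show ?thesis using Least_le[of "\<lambda>m. m \<in> E"] unfolding d_def by fastforce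
  qed
  then have least: "least_entry n A d"
    using B(4,5) by (simp add: least_entry_def)
  have Bc: "B \<in> carrier_mat n n" using unimodular_equiv_carrier[OF B(1) A] .
  define C where "C = swaprows_mat n 0 i * B * swaprows_mat n 0 j"
  have n: "0 < n" using B(2) by simp
  have AC: "unimodular_equiv n A C"
    unfolding C_def
    by (intro unimodular_equiv_trans[OF B(1) _ A] unimodular_equivI unimodular_swaprows_mat n B(2,3))
  have "C = swapcols 0 j (swaprows 0 i B)"
    unfolding C_def swaprows_mat[OF Bc n B(2), symmetric]
    using n B(3) Bc by (intro swapcols_mat[symmetric]) simp_all
  then have C00: "C $$ (0, 0) = B $$ (i, j)" "C \<in> carrier_mat n n"
    using n B(2,3) Bc by auto
  show thesis
  proof (cases "0 \<le> B $$ (i, j)")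
    case True
    then show thesis using that[OF least AC] C00 B(5) by simp
  next
    case False
    have "unimodular_equiv n A (- 1\<^sub>m n * C)"
      using unimodular_equiv_trans[OF AC unimodular_equiv_left A] unimodular_uminus_one C00(2) by blast
    moreover have "(- 1\<^sub>m n * C) $$ (0, 0) = d"
      using C00 False B(5) n by simp
    ultimately show thesis using that[OF least] by blast
  qed
qed

lemma unimodular_equiv_clear_cross:
  assumes A: "A \<in> carrier_mat (Suc n) (Suc n)" and d: "least_entry (Suc n) A d"
    and B: "unimodular_equiv (Suc n) A B" "B $$ (0, 0) = d"
  obtains M where "M \<in> carrier_mat n n"
    "unimodular_equiv (Suc n) A (four_block_mat (d \<cdot>\<^sub>m 1\<^sub>m 1) (0\<^sub>m 1 n) (0\<^sub>m n 1) M)"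
proof -
  have Bc: "B \<in> carrier_mat (Suc n) (Suc n)" using unimodular_equiv_carrier[OF B(1) A] .
  define R where "R = mat 1 n (\<lambda>(i, j). B $$ (0, Suc j))"
  define C where "C = mat n 1 (\<lambda>(i, j). B $$ (Suc i, 0))"
  define M where "M = mat n n (\<lambda>(i, j). B $$ (Suc i, Suc j))"
  define V where "V = mat n 1 (\<lambda>(i, j). - (B $$ (Suc i, 0) div d))"
  define W where "W = mat 1 n (\<lambda>(i, j). - (B $$ (0, Suc j) div d))"
  let ?D = "d \<cdot>\<^sub>m 1\<^sub>m 1 :: int mat"
  have car: "R \<in> carrier_mat 1 n" "C \<in> carrier_mat n 1" "M \<in> carrier_mat n n" "V \<in> carrier_mat n 1"
      "W \<in> carrier_mat 1 n" "?D \<in> carrier_mat 1 1"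
    by (auto simp: R_def C_def M_def V_def W_def)
  have B_eq: "B = four_block_mat ?D R C M"
  proof (rule eq_matI)
    fix i j assume "i < dim_row (four_block_mat ?D R C M)" "j < dim_col (four_block_mat ?D R C M)"
    then have "i < Suc n" "j < Suc n" using car by auto
    then show "B $$ (i, j) = four_block_mat ?D R C M $$ (i, j)"
      using B(2) car by (cases i; cases j) (auto simp: R_def C_def M_def)
  qed (use Bc car in auto)
  have VC: "V * ?D + C = 0\<^sub>m n 1"
  proof (rule eq_matI)
    fix i j assume "i < dim_row (0\<^sub>m n 1 :: int mat)" "j < dim_col (0\<^sub>m n 1 :: int mat)"
    then have "i < n" "j = 0" by auto
    then show "(V * ?D + C) $$ (i, j) = 0\<^sub>m n 1 $$ (i, j)"
      using least_entry_dvd_col[OF A d B, of "Suc i"] car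
      by (simp add: V_def C_def scalar_prod_def)
  qed (use car in auto)
  have WR: "?D * W + R = 0\<^sub>m 1 n"
  proof (rule eq_matI)
    fix i j assume "i < dim_row (0\<^sub>m 1 n :: int mat)" "j < dim_col (0\<^sub>m 1 n :: int mat)"
    then have "i = 0" "j < n" by auto
    then show "(?D * W + R) $$ (i, j) = 0\<^sub>m 1 n $$ (i, j)"
      using least_entry_dvd_row[OF A d B, of "Suc j"] car
      by (simp add: W_def R_def scalar_prod_def)
  qed (use car in auto)
  define L where "L = four_block_mat (1\<^sub>m 1) (0\<^sub>m 1 n) V (1\<^sub>m n)"
  define U where "U = four_block_mat (1\<^sub>m 1) W (0\<^sub>m n 1) (1\<^sub>m n)"
  have LU: "unimodular (Suc n) L" "unimodular (Suc n) U"
    unfolding L_def U_def using unimodular_four_block_lower unimodular_four_block_upper car by auto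
  have "L * B = four_block_mat ?D R (0\<^sub>m n 1) (V * R + M)"
    unfolding L_def B_eq using car VC
    by (subst mult_four_block_mat[of _ 1 1 _ n _ n _ _ 1 _ n]) auto
  then have "L * B * U = four_block_mat ?D (0\<^sub>m 1 n) (0\<^sub>m n 1) (V * R + M)"
    unfolding U_def using car WR
    by (simp, subst mult_four_block_mat[of _ 1 1 _ n _ n _ _ 1 _ n]) auto
  moreover have "unimodular_equiv (Suc n) A (L * B * U)"
    by (intro unimodular_equiv_trans[OF B(1) _ A] unimodular_equivI LU)
  ultimately show thesis using that[of "V * R + M"] car by auto
qed

lemma exists_unimodular_equiv_smith_form:
  assumes "A \<in> carrier_mat n n"
  shows "\<exists>S. unimodular_equiv n A S \<and> diagonal_mat S \<and> (\<forall>i < n. 0 \<le> S $$ (i, i)) \<and>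
    (\<forall>i. Suc i < n \<longrightarrow> S $$ (i, i) dvd S $$ (Suc i, Suc i))"
  using assms
proof (induction n arbitrary: A)
  case 0
  then show ?case
    using unimodular_equiv_refl by (intro exI[of _ A]) (auto simp: diagonal_mat_def)
next
  case (Suc n)
  show ?case
  proof (cases "A = 0\<^sub>m (Suc n) (Suc n)")
    case True
    then show ?thesis
      using unimodular_equiv_refl[OF Suc.prems] by (intro exI[of _ A]) (auto simp: diagonal_mat_def)
  next
    case False
    then obtain d B where d: "least_entry (Suc n) A d" and B: "unimodular_equiv (Suc n) A B" "B $$ (0, 0) = d"
      using least_entry_exists[OF Suc.prems] by blast
    then obtain M where M: "M \<in> carrier_mat n n"
        "unimodular_equiv (Suc n) A (four_block_mat (d \<cdot>\<^sub>m 1\<^sub>m 1) (0\<^sub>m 1 n) (0\<^sub>m n 1) M)"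
      using unimodular_equiv_clear_cross[OF Suc.prems] by blast
    obtain T where T: "unimodular_equiv n M T" "diagonal_mat T" "\<And>i. i < n \<Longrightarrow> 0 \<le> T $$ (i, i)"
        "\<And>i. Suc i < n \<Longrightarrow> T $$ (i, i) dvd T $$ (Suc i, Suc i)"
      using Suc.IH[OF M(1)] by blast
    obtain P Q where PQ: "unimodular n P" "unimodular n Q" "T = P * M * Q"
      using T(1) by (auto simp: unimodular_equiv_def)
    have Tc: "T \<in> carrier_mat n n" using unimodular_equiv_carrier[OF T(1) M(1)] .
    let ?blk = "\<lambda>X. four_block_mat (1\<^sub>m 1) (0\<^sub>m 1 n) (0\<^sub>m n 1) X :: int mat"
    define S where "S = four_block_mat (d \<cdot>\<^sub>m 1\<^sub>m 1) (0\<^sub>m 1 n) (0\<^sub>m n 1) T"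
    have "S = ?blk P * four_block_mat (d \<cdot>\<^sub>m 1\<^sub>m 1) (0\<^sub>m 1 n) (0\<^sub>m n 1) M * ?blk Q"
      unfolding S_def PQ(3) using PQ(1,2)[THEN unimodular_carrier] M(1)
      by (simp add: mult_four_block_mat[of _ 1 1 _ n _ n _ _ 1 _ n])
    then have AS: "unimodular_equiv (Suc n) A S"
      using unimodular_equiv_trans[OF M(2) unimodular_equivI Suc.prems]
        unimodular_four_block_diag[OF PQ(1)] unimodular_four_block_diag[OF PQ(2)] by simp
    have S0: "S $$ (0, 0) = d" "\<And>i. i < n \<Longrightarrow> S $$ (Suc i, 0) = 0"
      "\<And>i j. i < n \<Longrightarrow> j < n \<Longrightarrow> S $$ (Suc i, Suc j) = T $$ (i, j)" "\<And>j. j < n \<Longrightarrow> S $$ (0, Suc j) = 0"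
      using Tc by (auto simp: S_def)
    have Sc: "dim_row S = Suc n" "dim_col S = Suc n" using Tc by (auto simp: S_def)
    have "diagonal_mat S"
      unfolding diagonal_mat_def Sc
    proof (intro allI impI)
      fix i j assume "i < Suc n" "j < Suc n" "i \<noteq> j"
      then show "S $$ (i, j) = 0"
        using S0 T(2) Tc by (cases i; cases j) (auto simp: diagonal_mat_def)
    qed
    moreover have "0 \<le> S $$ (i, i)" if "i < Suc n" for i
      using that S0 T(3) d by (cases i) (auto simp: least_entry_def)
    moreover have "S $$ (i, i) dvd S $$ (Suc i, Suc i)" if "Suc i < Suc n" for i
    proof (cases i)
      case 0
      then show ?thesis
        using least_entry_dvd_all[OF Suc.prems d AS S0(1), of 1 1] S0 that by simp
    next
      case (Suc k)
      then show ?thesis using S0(3) T(4) that by simp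
    qed
    ultimately show ?thesis using AS by blast
  qed
qed

lemma is_smith_normal_form_smith_normal_form:
  assumes A: "A \<in> carrier_mat n n"
  shows "is_smith_normal_form A (smith_normal_form A)"
proof -
  obtain S where S: "unimodular_equiv n A S" "diagonal_mat S" "\<forall>i < n. 0 \<le> S $$ (i, i)"
      "\<forall>i. Suc i < n \<longrightarrow> S $$ (i, i) dvd S $$ (Suc i, Suc i)"
    using exists_unimodular_equiv_smith_form[OF A] by blast
  obtain P Q where PQ: "unimodular n P" "unimodular n Q" "S = P * A * Q"
    using S(1) by (auto simp: unimodular_equiv_def)
  have "dim_row S = n" "dim_col S = n" "dim_row A = n" "dim_col A = n"
    using unimodular_equiv_carrier[OF S(1) A] A by auto
  then have "is_smith_normal_form A S"
    unfolding is_smith_normal_form_def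
    using S(2-4) PQ PQ(1,2)[THEN unimodular_carrier] PQ(1,2)[THEN unimodular_imp_invertible_mat]
    by (metis min.idem)
  then show ?thesis unfolding smith_normal_form_def by (rule someI)
qed

section \<open>Evaluation of integer polynomials and ideals\<close>

definition eval_monom :: "(nat \<Rightarrow> int) \<Rightarrow> (nat \<Rightarrow>\<^sub>0 nat) \<Rightarrow> int" where
  "eval_monom x m = (\<Prod>i \<in> Poly_Mapping.keys m. x i ^ Poly_Mapping.lookup m i)"

lemma eval_monom_superset:
  "finite A \<Longrightarrow> Poly_Mapping.keys m \<subseteq> A \<Longrightarrow> eval_monom x m = (\<Prod>i \<in> A. x i ^ Poly_Mapping.lookup m i)"
  unfolding eval_monom_def by (intro prod.mono_neutral_left) (auto simp: in_keys_iff)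

lemma eval_monom_add: "eval_monom x (m + m') = eval_monom x m * eval_monom x m'"
proof -
  let ?A = "Poly_Mapping.keys m \<union> Poly_Mapping.keys m'"
  have "Poly_Mapping.keys (m + m') \<subseteq> ?A" by (rule Poly_Mapping.keys_add)
  then show ?thesis
    by (simp add: eval_monom_superset[of ?A] lookup_add power_add prod.distrib)
qed

lemma poly_eval_superset:
  "finite A \<Longrightarrow> Poly_Mapping.keys p \<subseteq> A \<Longrightarrow>
    poly_eval x p = (\<Sum>m \<in> A. Poly_Mapping.lookup p m * eval_monom x m)"
  unfolding poly_eval_def eval_monom_def by (intro sum.mono_neutral_left) (auto simp: in_keys_iff)

lemma poly_eval_single: "poly_eval x (Poly_Mapping.single m c) = c * eval_monom x m"
  by (simp add: poly_eval_superset[of "{m}"])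

lemma poly_eval_zero: "poly_eval x 0 = 0"
  by (simp add: poly_eval_def)

lemma poly_eval_add: "poly_eval x (p + q) = poly_eval x p + poly_eval x q"
proof -
  let ?A = "Poly_Mapping.keys p \<union> Poly_Mapping.keys q"
  have "Poly_Mapping.keys (p + q) \<subseteq> ?A" by (rule Poly_Mapping.keys_add)
  then show ?thesis
    by (simp add: poly_eval_superset[of ?A] lookup_add distrib_right sum.distrib)
qed

lemma poly_eval_sum: "poly_eval x (sum f A) = (\<Sum>a \<in> A. poly_eval x (f a))"
  by (induction A rule: infinite_finite_induct) (auto simp: poly_eval_zero poly_eval_add)

lemma poly_mapping_eq_sum_single:
  "p = (\<Sum>m \<in> Poly_Mapping.keys p. Poly_Mapping.single m (Poly_Mapping.lookup p m))"
proof (rule poly_mapping_eqI)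
  fix k
  show "Poly_Mapping.lookup p k =
      Poly_Mapping.lookup (\<Sum>m \<in> Poly_Mapping.keys p. Poly_Mapping.single m (Poly_Mapping.lookup p m)) k"
    by (simp add: lookup_sum lookup_single when_def in_keys_iff)
qed

lemma poly_eval_mult: "poly_eval x (p * q) = poly_eval x p * poly_eval x q"
proof -
  let ?s = "\<lambda>p m. Poly_Mapping.single m (Poly_Mapping.lookup p m) :: int_mpoly"
  have "p * q = (\<Sum>m \<in> Poly_Mapping.keys p. \<Sum>m' \<in> Poly_Mapping.keys q. ?s p m * ?s q m')"
    unfolding sum_product[symmetric]
    by (rule arg_cong2[where f = "(*)", OF poly_mapping_eq_sum_single poly_mapping_eq_sum_single])
  also have "poly_eval x \<dots> =
      (\<Sum>m \<in> Poly_Mapping.keys p. \<Sum>m' \<in> Poly_Mapping.keys q.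
        (Poly_Mapping.lookup p m * eval_monom x m) * (Poly_Mapping.lookup q m' * eval_monom x m'))"
    by (simp add: poly_eval_sum mult_single poly_eval_single eval_monom_add algebra_simps)
  also have "\<dots> = poly_eval x p * poly_eval x q"
    by (simp only: sum_product [symmetric] poly_eval_def eval_monom_def)
  finally show ?thesis .
qed

lemma poly_eval_of_int: "poly_eval x (of_int c) = c"
  unfolding single_of_int[symmetric] by (simp only: poly_eval_single) (simp add: eval_monom_def)

lemma poly_eval_one: "poly_eval x 1 = 1"
  unfolding single_one[symmetric] by (simp only: poly_eval_single) (simp add: eval_monom_def)

interpretation poly_eval: comm_ring_hom "poly_eval x" for x
  by unfold_locales (auto simp: poly_eval_zero poly_eval_one poly_eval_add poly_eval_mult)

lemma poly_eval_indet: "poly_eval x (indet i) = x i"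
  unfolding indet_def by (simp only: poly_eval_single) (simp add: eval_monom_def)

definition vars_within :: "nat \<Rightarrow> int_mpoly \<Rightarrow> bool" where
  "vars_within n p \<longleftrightarrow> (\<forall>m \<in> Poly_Mapping.keys p. Poly_Mapping.keys m \<subseteq> {..<n})"

lemma carrier_int_poly_ring: "p \<in> carrier (int_poly_ring n) \<longleftrightarrow> vars_within n p"
  by (simp add: int_poly_ring_def vars_within_def)

lemma int_poly_ring_simps:
  "mult (int_poly_ring n) = (*)" "one (int_poly_ring n) = 1"
  "zero (int_poly_ring n) = 0" "add (int_poly_ring n) = (+)"
  by (simp_all add: int_poly_ring_def)

lemma vars_within_single: "Poly_Mapping.keys m \<subseteq> {..<n} \<Longrightarrow> vars_within n (Poly_Mapping.single m c)"
  by (auto simp: vars_within_def)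

lemma vars_within_zero: "vars_within n 0"
  by (simp add: vars_within_def)

lemma vars_within_of_int: "vars_within n (of_int c)"
  unfolding single_of_int[symmetric] by (rule vars_within_single) simp

lemma vars_within_one: "vars_within n 1"
  using vars_within_of_int[of n 1] by simp

lemma vars_within_uminus: "vars_within n p \<Longrightarrow> vars_within n (- p)"
  by (simp add: vars_within_def)

lemma vars_within_add: "vars_within n p \<Longrightarrow> vars_within n q \<Longrightarrow> vars_within n (p + q)"
  using Poly_Mapping.keys_add[of p q] by (fastforce simp: vars_within_def)

lemma vars_within_mult:
  assumes "vars_within n p" "vars_within n q"
  shows "vars_within n (p * q)"
  unfolding vars_within_def
proof
  fix m assume "m \<in> Poly_Mapping.keys (p * q)"
  then obtain a b where "m = a + b" "a \<in> Poly_Mapping.keys p" "b \<in> Poly_Mapping.keys q"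
    using keys_mult[of p q] by blast
  then show "Poly_Mapping.keys m \<subseteq> {..<n}"
    using assms Poly_Mapping.keys_add[of a b] by (fastforce simp: vars_within_def)
qed

lemma vars_within_sum: "(\<And>a. a \<in> A \<Longrightarrow> vars_within n (f a)) \<Longrightarrow> vars_within n (sum f A)"
  by (induction A rule: infinite_finite_induct) (auto simp: vars_within_zero vars_within_add)

lemma vars_within_prod: "(\<And>a. a \<in> A \<Longrightarrow> vars_within n (f a)) \<Longrightarrow> vars_within n (prod f A)"
  by (induction A rule: infinite_finite_induct) (auto simp: vars_within_one vars_within_mult)

lemma cring_int_poly_ring: "cring (int_poly_ring n)"
proof (rule cringI)
  show "abelian_group (int_poly_ring n)"
  proof (rule abelian_groupI)
    fix p assume "p \<in> carrier (int_poly_ring n)"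
    then show "\<exists>q \<in> carrier (int_poly_ring n). q \<oplus>\<^bsub>int_poly_ring n\<^esub> p = \<zero>\<^bsub>int_poly_ring n\<^esub>"
      by (intro bexI[of _ "- p"]) (simp_all add: carrier_int_poly_ring int_poly_ring_simps vars_within_uminus)
  qed (simp_all add: carrier_int_poly_ring int_poly_ring_simps vars_within_add vars_within_zero ac_simps)
  show "comm_monoid (int_poly_ring n)"
    by (rule comm_monoidI)
      (simp_all add: carrier_int_poly_ring int_poly_ring_simps vars_within_mult vars_within_one ac_simps)
qed (simp add: int_poly_ring_simps distrib_right)

lemma vars_within_det:
  assumes A: "A \<in> carrier_mat k k" and "\<And>i j. i < k \<Longrightarrow> j < k \<Longrightarrow> vars_within n (A $$ (i, j))"
  shows "vars_within n (det A)"
  unfolding det_def'[OF A]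
proof (intro vars_within_sum vars_within_mult vars_within_prod)
  fix p :: "nat \<Rightarrow> nat"
  show "vars_within n (signof p)"
    by (cases p rule: sign_cases) (simp_all add: vars_within_one vars_within_uminus)
next
  fix p i assume "p \<in> {p. p permutes {0..<k}}" "i \<in> {0..<k}"
  then have "p i < k" "i < k" using permutes_in_image[of p "{0..<k}" i] by auto
  then show "vars_within n (A $$ (i, p i))" using assms(2) by blast
qed

lemma submatrix_carrier_mat:
  assumes "I \<subseteq> {..<dim_row A}" "J \<subseteq> {..<dim_col A}" "card I = k" "card J = k"
  shows "submatrix A I J \<in> carrier_mat k k"
proof -
  have "{i. i < dim_row A \<and> i \<in> I} = I" "{j. j < dim_col A \<and> j \<in> J} = J"
    using assms by auto
  then show ?thesis using assms(3,4) by (intro carrier_matI) (simp_all only: dim_submatrix)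
qed

lemma submatrix_entry:
  assumes "I \<subseteq> {..<dim_row A}" "J \<subseteq> {..<dim_col A}" "card I = k" "card J = k" "i < k" "j < k"
  shows "submatrix A I J $$ (i, j) = A $$ (pick I i, pick J j)"
    and "pick I i < dim_row A" "pick J j < dim_col A"
proof -
  have "{i. i < dim_row A \<and> i \<in> I} = I" "{j. j < dim_col A \<and> j \<in> J} = J"
    using assms by auto
  then have "card {i. i < dim_row A \<and> i \<in> I} = k" "card {j. j < dim_col A \<and> j \<in> J} = k"
    using assms(3,4) by (simp_all only:)
  then show "submatrix A I J $$ (i, j) = A $$ (pick I i, pick J j)"
    using assms(5,6) by (intro submatrix_index) (simp_all only:)
  have "finite I" "finite J" using assms(1,2) finite_subset by blast+
  then have "pick I i \<in> I" "pick J j \<in> J" using assms by (auto intro!: pick_in_set)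
  then show "pick I i < dim_row A" "pick J j < dim_col A" using assms by auto
qed

lemma (in comm_ring_hom) minors_map_mat: "minors k (map_mat hom A) = hom ` minors k A"
proof -
  have *: "submatrix (map_mat hom A) I J = map_mat hom (submatrix A I J)"
    if IJ: "I \<subseteq> {..<dim_row A}" "J \<subseteq> {..<dim_col A}" "card I = k" "card J = k" for I J
  proof -
    have IJ': "I \<subseteq> {..<dim_row (map_mat hom A)}" "J \<subseteq> {..<dim_col (map_mat hom A)}"
      using IJ by simp_all
    have dims: "submatrix A I J \<in> carrier_mat k k" "submatrix (map_mat hom A) I J \<in> carrier_mat k k"
      using submatrix_carrier_mat IJ IJ' by blast+
    show ?thesis
    proof (rule eq_matI)
      fix i j assume "i < dim_row (map_mat hom (submatrix A I J))" "j < dim_col (map_mat hom (submatrix A I J))"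
      then have ij: "i < k" "j < k" using dims by simp_all
      then show "submatrix (map_mat hom A) I J $$ (i, j) = map_mat hom (submatrix A I J) $$ (i, j)"
        using submatrix_entry[OF IJ ij] submatrix_entry(1)[OF IJ' IJ(3,4) ij] dims(1) by simp
    qed (use dims in simp_all)
  qed
  show ?thesis
  proof (intro equalityI subsetI)
    fix x assume "x \<in> minors k (map_mat hom A)"
    then obtain I J where IJ: "I \<subseteq> {..<dim_row A}" "J \<subseteq> {..<dim_col A}" "card I = k" "card J = k"
        "x = det (submatrix (map_mat hom A) I J)"
      by (auto simp: minors_def)
    then have "x = hom (det (submatrix A I J))" using * by simp
    then show "x \<in> hom ` minors k A" using IJ(1-4) unfolding minors_def by blast
  next
    fix x assume "x \<in> hom ` minors k A"
    then obtain I J where IJ: "I \<subseteq> {..<dim_row A}" "J \<subseteq> {..<dim_col A}" "card I = k" "card J = k"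
        "x = hom (det (submatrix A I J))"
      by (auto simp: minors_def)
    then have "x = det (submatrix (map_mat hom A) I J)" using * by simp
    then show "x \<in> minors k (map_mat hom A)"
      using IJ(1-4) unfolding minors_def index_map_mat(2,3) by blast
  qed
qed

lemma minors_empty:
  assumes "dim_row A < k"
  shows "minors k A = {}"
proof (rule equals0I)
  fix x assume "x \<in> minors k A"
  then obtain I where "I \<subseteq> {..<dim_row A}" "card I = k"
    unfolding minors_def by blast
  then show False using card_mono[of "{..<dim_row A}" I] assms by simp
qed

lemma int_set_closed_imp_multiples:
  fixes I :: "int set"
  assumes "0 \<in> I" and add: "\<And>a b. a \<in> I \<Longrightarrow> b \<in> I \<Longrightarrow> a + b \<in> I" and mult: "\<And>a c. a \<in> I \<Longrightarrow> c * a \<in> I"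
  obtains d where "I = {x * d |x. True}"
proof (cases "I = {0}")
  case True
  then show thesis using that[of 0] by simp
next
  case False
  then obtain a where a: "a \<in> I" "a \<noteq> 0" using assms(1) by auto
  then have "\<bar>a\<bar> \<in> I" using mult[OF a(1), of "-1"] by (cases "0 \<le> a") auto
  then have "int (nat \<bar>a\<bar>) \<in> I \<and> 0 < nat \<bar>a\<bar>" using a(2) by simp
  then have "int (LEAST m. int m \<in> I \<and> 0 < m) \<in> I \<and> 0 < (LEAST m. int m \<in> I \<and> 0 < m)"
    by (rule LeastI)
  moreover define d where "d = int (LEAST m. int m \<in> I \<and> 0 < m)"
  ultimately have d: "d \<in> I" "0 < d" by (simp_all only: of_nat_0_less_iff)
  have "d dvd b" if "b \<in> I" for b
  proof (rule ccontr)
    assume "\<not> d dvd b"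
    then have "b mod d \<noteq> 0" by (simp add: dvd_eq_mod_eq_0)
    then have "0 < b mod d" "b mod d < d"
      using pos_mod_sign[OF d(2), of b] pos_mod_bound[OF d(2), of b] by linarith+
    moreover have "b mod d = b + (- (b div d)) * d"
      by (simp add: minus_div_mult_eq_mod [symmetric])
    then have "b mod d \<in> I"
      using add[OF that mult[OF d(1), of "- (b div d)"]] by (simp only:)
    ultimately have "nat (b mod d) < nat d" "int (nat (b mod d)) \<in> I \<and> 0 < nat (b mod d)"
      using d(2) by simp_all
    then show False
      using not_less_Least[of "nat (b mod d)" "\<lambda>m. int m \<in> I \<and> 0 < m"]
      unfolding d_def nat_int by blast
  qed
  then have "I = {x * d |x. True}"
    using mult[OF d(1)] by (auto simp: dvd_def mult.commute)
  then show thesis by (rule that)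
qed

lemma poly_eval_image_Idl:
  assumes S: "S \<subseteq> carrier (int_poly_ring n)"
  shows "poly_eval x ` (Idl\<^bsub>int_poly_ring n\<^esub> S) = Idl\<^bsub>\<Z>\<^esub> {Gcd (poly_eval x ` S)}"
proof -
  interpret R: cring "int_poly_ring n" by (rule cring_int_poly_ring)
  have hom: "poly_eval x \<in> Ring.ring_hom (int_poly_ring n) \<Z>"
    by (rule ring_hom_memI) (simp_all add: int_poly_ring_simps poly_eval_mult poly_eval_add poly_eval_one)
  have Z: "ring \<Z>" by (rule cring.axioms(1)[OF int_is_cring])
  have h: "ring_hom_ring (int_poly_ring n) \<Z> (poly_eval x)"
    by (rule ring_hom_ringI2[OF R.ring_axioms Z hom])
  let ?J = "Idl\<^bsub>int_poly_ring n\<^esub> S"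
  let ?I = "Idl\<^bsub>\<Z>\<^esub> {Gcd (poly_eval x ` S)}"
  have J: "ideal ?J (int_poly_ring n)" by (rule R.genideal_ideal[OF S])
  have J0: "0 \<in> ?J"
    using additive_subgroup.zero_closed[OF ideal.axioms(1)[OF J]] unfolding int_poly_ring_simps .
  have J_add: "p + q \<in> ?J" if "p \<in> ?J" "q \<in> ?J" for p q
    using additive_subgroup.a_closed[OF ideal.axioms(1)[OF J] that] unfolding int_poly_ring_simps .
  have J_mult: "of_int c * p \<in> ?J" if "p \<in> ?J" for c p
    using ideal.I_l_closed[OF J that, of "of_int c"]
    unfolding int_poly_ring_simps carrier_int_poly_ring by (simp only: vars_within_of_int)
  have "0 \<in> poly_eval x ` ?J"
    using imageI[OF J0, of "poly_eval x"] by (simp only: poly_eval_zero)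
  moreover have "a + b \<in> poly_eval x ` ?J" if ab: "a \<in> poly_eval x ` ?J" "b \<in> poly_eval x ` ?J" for a b
  proof -
    obtain p q where "p \<in> ?J" "q \<in> ?J" "a = poly_eval x p" "b = poly_eval x q"
      using ab by blast
    then show ?thesis
      using imageI[OF J_add[of p q], of "poly_eval x"] by (simp only: poly_eval_add)
  qed
  moreover have "c * a \<in> poly_eval x ` ?J" if a: "a \<in> poly_eval x ` ?J" for a c
  proof -
    obtain p where "p \<in> ?J" "a = poly_eval x p"
      using a by blast
    then show ?thesis
      using imageI[OF J_mult[of p c], of "poly_eval x"] by (simp only: poly_eval_mult poly_eval_of_int)
  qed
  ultimately obtain d where d: "poly_eval x ` ?J = {y * d |y. True}"
    by (rule int_set_closed_imp_multiples)
  have "poly_eval x ` S \<subseteq> poly_eval x ` ?J"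
    using R.genideal_self[OF S] by blast
  then have "d dvd Gcd (poly_eval x ` S)"
    unfolding d by (intro Gcd_greatest) auto
  then have "?I \<subseteq> poly_eval x ` ?J"
    unfolding d by (simp only: int_Idl [symmetric] Idl_subset_eq_dvd)
  moreover have "ideal {p \<in> carrier (int_poly_ring n). poly_eval x p \<in> ?I} (int_poly_ring n)"
    by (rule ring_hom_ring.ideal_vimage[OF h ring.genideal_ideal[OF Z]]) simp
  then have "?J \<subseteq> {p \<in> carrier (int_poly_ring n). poly_eval x p \<in> ?I}"
  proof (rule R.genideal_minimal)
    show "S \<subseteq> {p \<in> carrier (int_poly_ring n). poly_eval x p \<in> ?I}"
    proof
      fix p assume p: "p \<in> S"
      then have "Gcd (poly_eval x ` S) dvd poly_eval x p" by (intro Gcd_dvd imageI)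
      then have "poly_eval x p \<in> ?I" by (auto simp: int_Idl dvd_def mult.commute)
      with p S show "p \<in> {p \<in> carrier (int_poly_ring n). poly_eval x p \<in> ?I}" by blast
    qed
  qed
  ultimately show ?thesis by blast
qed

section \<open>Minors and invariant factors\<close>

lemma det_cong_mod:
  fixes A B :: "int mat"
  assumes A: "A \<in> carrier_mat k k" and B: "B \<in> carrier_mat k k"
    and AB: "\<And>i j. i < k \<Longrightarrow> j < k \<Longrightarrow> [A $$ (i, j) = B $$ (i, j)] (mod q)"
  shows "[det A = det B] (mod q)"
  unfolding det_def'[OF A] det_def'[OF B]
proof (intro cong_sum cong_mult cong_refl cong_prod)
  fix p i assume "p \<in> {p. p permutes {0..<k}}" "i \<in> {0..<k}"
  then have "p i < k" "i < k" using permutes_in_image[of p "{0..<k}" i] by auto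
  then show "[A $$ (i, p i) = B $$ (i, p i)] (mod q)" using AB by blast
qed

lemma det_mult_zero_col:
  fixes X Y :: "'a :: comm_ring_1 mat"
  assumes X: "X \<in> carrier_mat k k" and Y: "Y \<in> carrier_mat k k"
    and r: "r < k" and col: "\<And>i. i < k \<Longrightarrow> X $$ (i, r) = 0"
  shows "det (X * Y) = 0"
proof -
  have "det X = 0"
    unfolding det_def'[OF X]
  proof (intro sum.neutral ballI)
    fix p assume "p \<in> {p. p permutes {0..<k}}"
    then have p: "p permutes {0..<k}" by simp
    then obtain i where "i < k" "p i = r"
      using r by (metis atLeast0LessThan lessThan_iff permutes_image imageE)
    then have "(\<Prod>i = 0..<k. X $$ (i, p i)) = 0"
      using col[of i] by (intro prod_zero bexI[of _ i]) simp_all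
    then show "signof p * (\<Prod>i = 0..<k. X $$ (i, p i)) = 0" by simp
  qed
  then show ?thesis using det_mult[OF X Y] by simp
qed

lemma index_mult_mat_sum:
  "A \<in> carrier_mat m n \<Longrightarrow> B \<in> carrier_mat n p \<Longrightarrow> i < m \<Longrightarrow> j < p \<Longrightarrow>
    (A * B) $$ (i, j) = (\<Sum>l<n. A $$ (i, l) * B $$ (l, j))"
  by (auto simp: scalar_prod_def atLeast0LessThan)

text \<open>Modulo \<open>q\<close>, a minor of \<open>P * S * Q\<close> is the determinant of a product through \<open>r < k\<close> dimensions.\<close>

lemma dvd_minors_of_dvd_diagonal:
  fixes P S Q :: "int mat"
  assumes P: "P \<in> carrier_mat n n" and S: "S \<in> carrier_mat n n" and Q: "Q \<in> carrier_mat n n"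
    and diag: "diagonal_mat S" and q: "\<And>i. r \<le> i \<Longrightarrow> i < n \<Longrightarrow> q dvd S $$ (i, i)"
    and r: "r < k" "r \<le> n" and x: "x \<in> minors k (P * S * Q)"
  shows "q dvd x"
proof -
  let ?M = "P * S * Q"
  obtain I J where IJ: "I \<subseteq> {..<n}" "J \<subseteq> {..<n}" "card I = k" "card J = k"
      "x = det (submatrix ?M I J)"
    using x P Q by (auto simp: minors_def)
  have entry: "?M $$ (a, b) = (\<Sum>l<n. P $$ (a, l) * S $$ (l, l) * Q $$ (l, b))" if "a < n" "b < n" for a b
  proof -
    have "(P * S) $$ (a, l) = P $$ (a, l) * S $$ (l, l)" if "l < n" for l
    proof -
      have "(P * S) $$ (a, l) = (\<Sum>m<n. P $$ (a, m) * S $$ (m, l))"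
        by (rule index_mult_mat_sum[OF P S \<open>a < n\<close> that])
      also have "\<dots> = (\<Sum>m<n. if m = l then P $$ (a, l) * S $$ (l, l) else 0)"
        using diag S that by (intro sum.cong) (auto simp: diagonal_mat_def)
      finally show ?thesis using that by simp
    qed
    moreover have "?M $$ (a, b) = (\<Sum>l<n. (P * S) $$ (a, l) * Q $$ (l, b))"
      by (rule index_mult_mat_sum[OF _ Q that]) (use P S in simp)
    ultimately show ?thesis by simp
  qed
  define X where "X = mat k k (\<lambda>(i, l). if l < r then P $$ (pick I i, l) * S $$ (l, l) else 0)"
  define Y where "Y = mat k k (\<lambda>(l, j). if l < r then Q $$ (l, pick J j) else 0)"
  have XY: "X \<in> carrier_mat k k" "Y \<in> carrier_mat k k" by (auto simp: X_def Y_def)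
  have dims: "I \<subseteq> {..<dim_row ?M}" "J \<subseteq> {..<dim_col ?M}" using IJ P Q by auto
  have "[submatrix ?M I J $$ (i, j) = (X * Y) $$ (i, j)] (mod q)" if ij: "i < k" "j < k" for i j
  proof -
    let ?t = "\<lambda>l. P $$ (pick I i, l) * S $$ (l, l) * Q $$ (l, pick J j)"
    note sub = submatrix_entry[OF dims IJ(3,4) ij]
    have "submatrix ?M I J $$ (i, j) = (\<Sum>l<n. ?t l)"
      using sub entry[of "pick I i" "pick J j"] P Q by simp
    also have "\<dots> = (\<Sum>l<r. ?t l) + (\<Sum>l\<in>{r..<n}. ?t l)"
      using sum.atLeastLessThan_concat[OF le0 r(2), of ?t] unfolding lessThan_atLeast0 by (rule sym)
    finally have left: "submatrix ?M I J $$ (i, j) = (\<Sum>l<r. ?t l) + (\<Sum>l\<in>{r..<n}. ?t l)" .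
    have "(\<Sum>l<r. ?t l) = (\<Sum>l<r. X $$ (i, l) * Y $$ (l, j))"
      using r(1) ij by (intro sum.cong refl) (simp add: X_def Y_def)
    also have "\<dots> = (\<Sum>l<k. X $$ (i, l) * Y $$ (l, j))"
      using r(1) ij by (intro sum.mono_neutral_left) (auto simp: X_def)
    also have "\<dots> = (X * Y) $$ (i, j)"
      by (rule index_mult_mat_sum[OF XY ij, symmetric])
    finally have right: "(\<Sum>l<r. ?t l) = (X * Y) $$ (i, j)" .
    have "[(\<Sum>l<r. ?t l) + (\<Sum>l\<in>{r..<n}. ?t l) = (\<Sum>l<r. ?t l) + 0] (mod q)"
      by (intro cong_add cong_refl) (auto simp: cong_0_iff intro!: dvd_sum dvd_mult2[OF dvd_mult[OF q]])
    then show ?thesis unfolding left right add_0_right .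
  qed
  then have "[x = det (X * Y)] (mod q)"
    unfolding IJ(5) using XY submatrix_carrier_mat[OF dims IJ(3,4)] by (intro det_cong_mod) auto
  moreover have "det (X * Y) = 0"
    by (rule det_mult_zero_col[OF XY r(1)]) (use r(1) in \<open>simp add: X_def\<close>)
  ultimately show ?thesis by (simp add: cong_0_iff)
qed

lemma le_f1_of_Delta_eq_1:
  assumes M: "M \<in> carrier_mat n n" and k: "1 \<le> k" and D: "Delta k M = 1"
  shows "nat k \<le> f1 M"
proof -
  define S where "S = smith_normal_form M"
  have snf: "is_smith_normal_form M S"
    unfolding S_def by (rule is_smith_normal_form_smith_normal_form[OF M])
  then obtain P Q where PQ: "P \<in> carrier_mat n n" "Q \<in> carrier_mat n n" "invertible_mat P" "invertible_mat Q"
      "S = P * M * Q"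
    using M by (auto simp: is_smith_normal_form_def)
  have S: "S \<in> carrier_mat n n" using PQ M by simp
  have diag: "diagonal_mat S" and nonneg: "\<And>i. i < n \<Longrightarrow> 0 \<le> S $$ (i, i)"
    and chain: "\<And>i. Suc i < n \<Longrightarrow> S $$ (i, i) dvd S $$ (Suc i, Suc i)"
    using snf S by (auto simp: is_smith_normal_form_def)
  obtain P' Q' where inv: "P * P' = 1\<^sub>m n" "P' * P = 1\<^sub>m (dim_row P')" "Q * Q' = 1\<^sub>m n" "Q' * Q = 1\<^sub>m (dim_row Q')"
    using PQ by (auto simp: invertible_mat_def inverts_mat_def)
  have P': "P' \<in> carrier_mat n n" and Q': "Q' \<in> carrier_mat n n"
    using inv PQ(1,2) by (metis carrier_matD(2) carrier_matI index_mult_mat(3) index_one_mat(3))+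
  have "P' * S * Q' = (P' * P) * M * (Q * Q')"
    unfolding PQ(5) using P' Q' PQ(1,2) M by (simp add: assoc_mult_mat[of _ n n _ n _ n])
  then have M_eq: "M = P' * S * Q'"
    using inv P' M by simp
  have D1: "Gcd (minors (nat k) M) = 1" using D k by (simp add: Delta_def)
  have "nat k \<le> n"
  proof (rule ccontr)
    assume "\<not> nat k \<le> n"
    then have "minors (nat k) M = {}" using M by (intro minors_empty) auto
    then show False using D1 by simp
  qed
  have "S $$ (r, r) = 1" if r: "r < nat k" for r
  proof -
    have "S $$ (r, r) dvd S $$ (i, i)" if "r \<le> i" "i < n" for i
      using that by (induction i rule: dec_induct) (auto intro: dvd_trans chain)
    then have "S $$ (r, r) dvd x" if "x \<in> minors (nat k) M" for x
      using dvd_minors_of_dvd_diagonal[OF P' S Q' diag _ r, of "S $$ (r, r)" x] that M_eq r \<open>nat k \<le> n\<close>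
      by auto
    then have "S $$ (r, r) dvd 1"
      using D1 Gcd_greatest by metis
    then show ?thesis using nonneg[of r] r \<open>nat k \<le> n\<close> by simp
  qed
  then have "{..<nat k} \<subseteq> {i. i < n \<and> S $$ (i, i) = 1}"
    using \<open>nat k \<le> n\<close> by auto
  then have "card {..<nat k} \<le> card {i. i < n \<and> S $$ (i, i) = 1}"
    by (intro card_mono) auto
  then show ?thesis
    using M by (simp add: f1_def S_def)
qed

section \<open>Critical ideals\<close>

lemma generalized_laplacian_carrier:
  "generalized_laplacian G vs \<in> carrier_mat (length vs) (length vs)"
  unfolding generalized_laplacian_def adjacency_matrix_def by (intro minus_carrier_mat) simp

lemma generalized_laplacian_index:
  "i < length vs \<Longrightarrow> j < length vs \<Longrightarrow> generalized_laplacian G vs $$ (i, j) =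
    (if i = j then indet i else 0) - of_nat (adjacency_matrix G vs $$ (i, j))"
  by (auto simp: generalized_laplacian_def adjacency_matrix_def mat_diag_def)

lemma minors_generalized_laplacian_subset:
  "minors k (generalized_laplacian G vs) \<subseteq> carrier (int_poly_ring (length vs))"
proof
  let ?A = "generalized_laplacian G vs" and ?n = "length vs"
  have dims: "dim_row ?A = ?n" "dim_col ?A = ?n"
    using generalized_laplacian_carrier[of G vs] by auto
  have vars: "vars_within ?n (?A $$ (i, j))" if "i < ?n" "j < ?n" for i j
  proof -
    have "vars_within ?n (if i = j then indet i else 0)"
      using that by (auto simp: indet_def vars_within_zero intro!: vars_within_single)
    moreover have "vars_within ?n (- of_nat (adjacency_matrix G vs $$ (i, j)))"
      using vars_within_uminus[OF vars_within_of_int[of ?n "int (adjacency_matrix G vs $$ (i, j))"]] by simp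
    ultimately show ?thesis
      using that vars_within_add by (metis generalized_laplacian_index uminus_add_conv_diff add.commute)
  qed
  fix x assume "x \<in> minors k ?A"
  then obtain I J where IJ: "I \<subseteq> {..<dim_row ?A}" "J \<subseteq> {..<dim_col ?A}" "card I = k" "card J = k"
      "x = det (submatrix ?A I J)"
    by (auto simp: minors_def)
  have "vars_within ?n (submatrix ?A I J $$ (i, j))" if "i < k" "j < k" for i j
    using submatrix_entry[OF IJ(1-4) that] vars unfolding dims by simp
  then show "x \<in> carrier (int_poly_ring ?n)"
    unfolding IJ(5) carrier_int_poly_ring by (intro vars_within_det[OF submatrix_carrier_mat[OF IJ(1-4)]])
qed

lemma poly_eval_image_critical_ideal:
  assumes "map_mat (poly_eval x) (generalized_laplacian G vs) = C"
  shows "poly_eval x ` critical_ideal G vs k = Idl\<^bsub>\<Z>\<^esub> {Delta k C}"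
proof -
  let ?R = "int_poly_ring (length vs)"
  consider "k < 1" | "k > int (length vs)" "k \<ge> 1" | "1 \<le> k" "k \<le> int (length vs)" by linarith
  then show ?thesis
  proof cases
    case 1
    then have "poly_eval x ` critical_ideal G vs k = poly_eval x ` (Idl\<^bsub>?R\<^esub> {1})"
      by (simp add: critical_ideal_def)
    also have "\<dots> = Idl\<^bsub>\<Z>\<^esub> {Gcd (poly_eval x ` {1})}"
      by (rule poly_eval_image_Idl) (simp add: carrier_int_poly_ring vars_within_one)
    finally show ?thesis using 1 by (simp add: Delta_def poly_eval_one)
  next
    case 2
    then have "poly_eval x ` critical_ideal G vs k = poly_eval x ` (Idl\<^bsub>?R\<^esub> {0})"
      by (simp add: critical_ideal_def)
    also have "\<dots> = Idl\<^bsub>\<Z>\<^esub> {Gcd (poly_eval x ` {0})}"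
      by (rule poly_eval_image_Idl) (simp add: carrier_int_poly_ring vars_within_zero)
    finally have "poly_eval x ` critical_ideal G vs k = Idl\<^bsub>\<Z>\<^esub> {0}"
      by (simp add: poly_eval_zero)
    moreover have "dim_row C = length vs"
      using generalized_laplacian_carrier[of G vs] assms by (metis carrier_matD(1) index_map_mat(2))
    then have "minors (nat k) C = {}" using 2 by (intro minors_empty) auto
    ultimately show ?thesis using 2 by (simp add: Delta_def)
  next
    case 3
    then have "poly_eval x ` critical_ideal G vs k =
        poly_eval x ` (Idl\<^bsub>?R\<^esub> (minors (nat k) (generalized_laplacian G vs)))"
      by (simp add: critical_ideal_def)
    also have "\<dots> = Idl\<^bsub>\<Z>\<^esub> {Gcd (poly_eval x ` minors (nat k) (generalized_laplacian G vs))}"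
      by (rule poly_eval_image_Idl[OF minors_generalized_laplacian_subset])
    also have "poly_eval x ` minors (nat k) (generalized_laplacian G vs) = minors (nat k) C"
      using poly_eval.minors_map_mat[of "nat k" x "generalized_laplacian G vs"] assms by simp
    finally show ?thesis using 3 by (simp add: Delta_def)
  qed
qed

lemma algebraic_corank_le_f1:
  assumes C: "map_mat (poly_eval x) (generalized_laplacian G vs) = C"
  shows "algebraic_corank G vs \<le> f1 C"
proof -
  have Cc: "C \<in> carrier_mat (length vs) (length vs)"
    using generalized_laplacian_carrier[of G vs] C by auto
  have "nat k \<le> f1 C" if k: "1 \<le> k" "critical_ideal G vs k = Idl\<^bsub>int_poly_ring (length vs)\<^esub> {1}" for k
  proof -
    have "Idl\<^bsub>\<Z>\<^esub> {Delta k C} = Idl\<^bsub>\<Z>\<^esub> {Delta 0 C}"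
      using k(2) poly_eval_image_critical_ideal[OF C, of k] poly_eval_image_critical_ideal[OF C, of 0]
      by (simp add: critical_ideal_def)
    then have "\<bar>Delta k C\<bar> = 1" unfolding Idl_eq_abs by (simp add: Delta_def)
    then have "Delta k C = 1" using k(1) by (simp add: Delta_def)
    then show ?thesis by (rule le_f1_of_Delta_eq_1[OF Cc k(1)])
  qed
  then have "{k. 1 \<le> k \<and> critical_ideal G vs k = Idl\<^bsub>int_poly_ring (length vs)\<^esub> {1}} \<subseteq> {1..int (f1 C)}"
    by force
  then have "algebraic_corank G vs \<le> card {1..int (f1 C)}"
    unfolding algebraic_corank_def by (intro card_mono) auto
  then show ?thesis by simp
qed

theorem mainTheorem1:
  fixes H :: plane_drawing
    and fs :: "complex set list"
    and G :: "(complex set, complex set) multigraph"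
    and c :: "nat \<Rightarrow> nat"
  assumes "plane_graph H"
    and "distinct fs" and "set fs = interior_faces H"
    and "\<forall>f \<in> interior_faces H. \<exists>Z. bounded_by_cycle H f Z"
    and "G = weak_dual H"
    and "\<forall>i < length fs. c i = cycle_length H (fs ! i)"
  shows "(\<forall>k::int. poly_eval (\<lambda>i. int (c i)) ` critical_ideal G fs k
            = Idl\<^bsub>\<Z>\<^esub> {Delta k (cycle_intersection_matrix H fs)})
       \<and> f1 (cycle_intersection_matrix H fs) \<ge> algebraic_corank G fs"
proof -
  let ?x = "\<lambda>i. int (c i)"
  have "map_mat (poly_eval ?x) (generalized_laplacian G fs) = cycle_intersection_matrix H fs"
  proof (rule eq_matI)
    fix i j assume "i < dim_row (cycle_intersection_matrix H fs)" "j < dim_col (cycle_intersection_matrix H fs)"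
    then have ij: "i < length fs" "j < length fs" by (auto simp: cycle_intersection_matrix_def)
    have "adjacency_matrix G fs $$ (i, j) =
        (if i = j then 0 else card (bounding_cycle H (fs ! i) \<inter> bounding_cycle H (fs ! j)))"
      unfolding assms(5) using assms(2-4) ij by (intro adjacency_matrix_weak_dual[OF assms(1)]) auto
    then have "poly_eval ?x (generalized_laplacian G fs $$ (i, j)) =
        (if i = j then int (c i) else - int (card (bounding_cycle H (fs ! i) \<inter> bounding_cycle H (fs ! j))))"
      using ij by (simp add: generalized_laplacian_index poly_eval.hom_minus poly_eval_indet
          poly_eval.hom_uminus poly_eval_of_int [of _ "int n" for n, simplified])
    then show "map_mat (poly_eval ?x) (generalized_laplacian G fs) $$ (i, j) =
        cycle_intersection_matrix H fs $$ (i, j)"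
      using ij assms(6) generalized_laplacian_carrier[of G fs]
      by (simp add: cycle_intersection_matrix_def)
  qed (use generalized_laplacian_carrier[of G fs] in \<open>auto simp: cycle_intersection_matrix_def\<close>)
  then show ?thesis
    using poly_eval_image_critical_ideal algebraic_corank_le_f1 by blast
qed

end
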